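(* Let $A$ be a pseudoline arrangement in the real projective plane, and let $C_A$ be the planar dual graph of the lift of $A$ to the oriented projective plane. Then $C_A$ is a partial cube. If moreover $A$ is simplicial, then the partial cube $C_A$ is cubic.
   Context: A pseudoline arrangement is a finite collection of curves (pseudolines) in the real projective plane, each topologically equivalent to a line (that is, closed, non-self-crossing, non-contractible curves), such that any two curves in the collection have a single point in common, at which they cross. Its cells are the connected components of the complement of the union of the curves. The arrangement is simplicial if each cell is a triangle, i.e. is bounded by three sides belonging to three curves of the arrangement. The oriented projective plane is the sphere $S^2$ viewed as the double cover of the projective plane (two signed points for each point of the projective plane). The lift of $A$ is the arrangement on $S^2$ of the preimages of the pseudolines of $A$ under the covering map; the preimage of each pseudoline is a simple closed curve. The graph $C_A$ has one vertex for each cell of the lifted arrangement (connected component of the complement in $S^2$ of the lifted curves), and two vertices are connected by an edge whenever the corresponding two cells share an edge (one-dimensional arc) of the lifted arrangement. A partial cube is an undirected graph whose vertices can be labeled by binary vectors (of a common length) in such a way that the graph distance between any two vertices equals the Hamming distance between their labels. A graph is cubic if every vertex has degree exactly three. *)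

theory Defs
  imports "HOL-Analysis.Analysis"
begin

text \<open>The real projective plane is the quotient of the unit sphere by the antipodal map, with the
  quotient topology. The map \<open>abs_proj_plane\<close>, restricted to \<open>sphere 0 1\<close>, is the covering map;
  its values off the unit sphere are meaningless.\<close>

quotient_type proj_plane = "real^3" / partial: "\<lambda>x y. norm x = 1 \<and> (y = x \<or> y = - x)"
proof (rule part_equivpI)
  show "\<exists>x::real^3. norm x = 1 \<and> (x = x \<or> x = - x)"
    by (rule exI[of _ "axis 1 1"]) simp
  show "symp (\<lambda>x y::real^3. norm x = 1 \<and> (y = x \<or> y = - x))"
    by (auto simp: symp_def)
  show "transp (\<lambda>x y::real^3. norm x = 1 \<and> (y = x \<or> y = - x))"
    by (auto simp: transp_def)
qed

definition lift_set :: "proj_plane set \<Rightarrow> (real^3) set" where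
  "lift_set U = {x \<in> sphere 0 1. abs_proj_plane x \<in> U}"

instantiation proj_plane :: topological_space
begin

definition open_proj_plane :: "proj_plane set \<Rightarrow> bool" where
  "open_proj_plane U \<longleftrightarrow> openin (top_of_set (sphere 0 1)) (lift_set U)"

instance
proof
  have "lift_set UNIV = sphere 0 1"
    by (auto simp: lift_set_def)
  then show "open (UNIV :: proj_plane set)"
    by (simp add: open_proj_plane_def)
next
  fix S T :: "proj_plane set"
  assume "open S" "open T"
  moreover have "lift_set (S \<inter> T) = lift_set S \<inter> lift_set T"
    by (auto simp: lift_set_def)
  ultimately show "open (S \<inter> T)"
    by (simp add: open_proj_plane_def openin_Int)
next
  fix K :: "proj_plane set set"
  assume "\<forall>S\<in>K. open S"
  moreover have "lift_set (\<Union>K) = \<Union>(lift_set ` K)"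
    by (auto simp: lift_set_def)
  ultimately show "open (\<Union>K)"
    by (auto simp: open_proj_plane_def intro: openin_Union)
qed

end

definition pseudoline :: "proj_plane set \<Rightarrow> bool" where
  "pseudoline P \<longleftrightarrow>
     (\<exists>g. simple_path g \<and> pathfinish g = pathstart g \<and> path_image g = P \<and>
          \<not> (\<exists>a. homotopic_loops UNIV g (\<lambda>t. a)))"

text \<open>Two curves cross at \<open>p\<close> if, in a suitable chart of the surface around \<open>p\<close>, they become the two
  coordinate axes of the plane and \<open>p\<close> becomes the origin.\<close>

definition cross_at :: "proj_plane \<Rightarrow> proj_plane set \<Rightarrow> proj_plane set \<Rightarrow> bool" where
  "cross_at p P Q \<longleftrightarrow>
     (\<exists>U (h :: proj_plane \<Rightarrow> complex) k.
        open U \<and> p \<in> U \<and> homeomorphism U UNIV h k \<and> h p = 0 \<and>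
        h ` (P \<inter> U) = {z. Im z = 0} \<and> h ` (Q \<inter> U) = {z. Re z = 0})"

definition pseudoline_arrangement :: "proj_plane set set \<Rightarrow> bool" where
  "pseudoline_arrangement A \<longleftrightarrow>
     finite A \<and> (\<forall>P\<in>A. pseudoline P) \<and>
     (\<forall>P\<in>A. \<forall>Q\<in>A. P \<noteq> Q \<longrightarrow> (\<exists>p. P \<inter> Q = {p} \<and> cross_at p P Q))"

text \<open>Here \<open>S\<close> is the ambient surface and \<open>A\<close> a collection of curves on it; the notions are used both
  for the projective plane (\<open>S = UNIV\<close>) and for the sphere. In the definition of \<open>sides\<close> the closure
  is taken in the ambient type; for \<open>S = sphere 0 1\<close> this agrees with the closure in \<open>S\<close>, as \<open>S\<close> is
  closed.\<close>

definition cells :: "'a::topological_space set \<Rightarrow> 'a set set \<Rightarrow> 'a set set" where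
  "cells S A = components (S - \<Union>A)"

definition arr_vertices :: "'a set set \<Rightarrow> 'a set" where
  "arr_vertices A = {x. \<exists>P\<in>A. \<exists>Q\<in>A. P \<noteq> Q \<and> x \<in> P \<and> x \<in> Q}"

definition arr_edges :: "'a::topological_space set set \<Rightarrow> 'a set set" where
  "arr_edges A = (\<Union>P\<in>A. components (P - arr_vertices A))"

definition sides :: "'a::topological_space set set \<Rightarrow> 'a set \<Rightarrow> 'a set set" where
  "sides A c = {e \<in> arr_edges A. e \<subseteq> closure c}"

definition triangle :: "'a::topological_space set set \<Rightarrow> 'a set \<Rightarrow> bool" where
  "triangle A c \<longleftrightarrow>
     (\<exists>P\<in>A. \<exists>Q\<in>A. \<exists>R\<in>A. \<exists>e f g. P \<noteq> Q \<and> Q \<noteq> R \<and> P \<noteq> R \<and>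
        e \<subseteq> P \<and> f \<subseteq> Q \<and> g \<subseteq> R \<and> card {e, f, g} = 3 \<and> sides A c = {e, f, g})"

definition simplicial :: "proj_plane set set \<Rightarrow> bool" where
  "simplicial A \<longleftrightarrow> (\<forall>c \<in> cells UNIV A. triangle A c)"

text \<open>A graph is given by its vertex set and its set of (two-element) edges. The distance is infinite
  between vertices that are not connected by a walk.\<close>

type_synonym 'a ugraph = "'a set \<times> 'a set set"

definition simple_graph :: "'a ugraph \<Rightarrow> bool" where
  "simple_graph G \<longleftrightarrow> (\<forall>e \<in> snd G. \<exists>u\<in>fst G. \<exists>v\<in>fst G. u \<noteq> v \<and> e = {u, v})"

definition graph_dist :: "'a ugraph \<Rightarrow> 'a \<Rightarrow> 'a \<Rightarrow> enat" where
  "graph_dist G u v = (INF n \<in> {n. (u, v) \<in> {(x, y). {x, y} \<in> snd G} ^^ n}. enat n)"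

definition hamming_dist :: "bool list \<Rightarrow> bool list \<Rightarrow> nat" where
  "hamming_dist xs ys = card {i. i < length xs \<and> xs ! i \<noteq> ys ! i}"

definition partial_cube :: "'a ugraph \<Rightarrow> bool" where
  "partial_cube G \<longleftrightarrow> simple_graph G \<and>
     (\<exists>n (l :: 'a \<Rightarrow> bool list). (\<forall>v \<in> fst G. length (l v) = n) \<and>
        (\<forall>u \<in> fst G. \<forall>v \<in> fst G. graph_dist G u v = enat (hamming_dist (l u) (l v))))"

definition cubic :: "'a ugraph \<Rightarrow> bool" where
  "cubic G \<longleftrightarrow> (\<forall>v \<in> fst G. card {e \<in> snd G. v \<in> e} = 3)"

definition dual_graph :: "'a::topological_space set \<Rightarrow> 'a set set \<Rightarrow> 'a set ugraph" where
  "dual_graph S A =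
     (cells S A,
      {{c, d} |c d. c \<in> cells S A \<and> d \<in> cells S A \<and> c \<noteq> d \<and> sides A c \<inter> sides A d \<noteq> {}})"

definition lift_arrangement :: "proj_plane set set \<Rightarrow> (real^3) set set" where
  "lift_arrangement A = lift_set ` A"

definition arrangement_graph :: "proj_plane set set \<Rightarrow> (real^3) set ugraph" where
  "arrangement_graph A = dual_graph (sphere 0 1) (lift_arrangement A)"

end

theory Submission
  imports Defs
begin

text \<open>
  Lift everything to the sphere. A pseudoline becomes a simple closed curve \<open>C\<close> with \<open>- C = C\<close>:
  its defining loop lifts to a path \<open>h\<close>, which cannot close up because a loop on the simply connected
  sphere would make the pseudoline contractible; so \<open>h\<close> runs from a point to its antipode, and
  \<open>C\<close> consists of \<open>h\<close> and \<open>- h\<close> (\<open>pseudoline_lift\<close>). The curves above two pseudolines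
  of an arrangement meet exactly in a pair \<open>{x, - x}\<close>. The locale \<open>antipodal_arrangement\<close> is about
  such families of curves.

  By the Jordan curve theorem each \<open>C\<close> has two sides, and the antipodal map exchanges them
  (\<open>antipode_not_in_side\<close>). Otherwise a path off \<open>C\<close> would join some \<open>a\<close> to \<open>- a\<close>; but two paths
  that both join antipodal points always meet up to sign (\<open>odd_paths_meet\<close>). The latter is an
  elementary argument with continuous logarithms; it expresses that two noncontractible loops in the
  projective plane intersect.

  A cell is labelled by the side of each curve on which it lies. The crucial fact is that two cells
  with the same label are equal, i.e. that an intersection of sides is connected
  (\<open>connected_region\<close>). This goes by induction on the number of curves with Janiszewski's theorem.
  Adding the curve \<open>C\<close>, the theorem needs that \<open>C\<close> meets the complement of the previous
  intersection in a connected set. By the antipodal symmetry every curve \<open>D\<close> cuts \<open>C\<close> into two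
  halves, one on each side of \<open>D\<close>, so the set in question is a union of closed halves of \<open>C\<close>, and any
  two closed halves of \<open>C\<close> intersect, since a half contains a point of each antipodal pair on \<open>C\<close>.

  Every point of \<open>C\<close> is a limit of points from either side of \<open>C\<close>. Hence, if the closure of a cell
  contains a point that lies on \<open>C\<close> only, then flipping the \<open>C\<close>-entry of the label
  gives a cell adjacent to it (\<open>neighbour_across\<close>), and adjacent cells differ in exactly one entry
  (\<open>share_side_iff\<close>). So the Hamming distance is a lower bound for the graph distance. It is attained:
  the intersection of those sides that two distinct cells have in common is connected, and remains
  so without the finitely many vertices, so the boundary of the first cell in it has a point, and the
  curve through this point separates the two cells (\<open>sep_step\<close>); crossing it decreases the Hamming
  distance.

  It follows that the degree of a cell is the number of curves that border it. The projection to the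
  projective plane maps the cell onto a cell of the original arrangement, bordered by the
  corresponding pseudolines; if that cell is a triangle, there are three of them.
\<close>

section \<open>Paths joining antipodal points\<close>

text \<open>Distinct values with the same exponential are at least \<open>2 * pi\<close> apart, so \<open>f\<close> cannot jump.\<close>

lemma const_of_exp_const:
  fixes f :: "real \<Rightarrow> complex"
  assumes f: "continuous_on {0..1} f" and e: "\<And>t. t \<in> {0..1} \<Longrightarrow> exp (f t) = w"
    and s: "s \<in> {0..1}" and t: "t \<in> {0..1}"
  shows "f s = f t"
proof -
  have "f constant_on {0..1}"
  proof (rule continuous_discrete_range_constant)
    show "connected {0..1::real}" by simp
    show "\<exists>e>0. \<forall>y. y \<in> {0..1} \<and> f y \<noteq> f x \<longrightarrow> e \<le> norm (f y - f x)" if "x \<in> {0..1}" for x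
    proof (intro exI[of _ "2 * pi"] conjI allI impI)
      fix y assume y: "y \<in> {0..1} \<and> f y \<noteq> f x"
      then have "exp (f y) = exp (f x)"
        using that by (simp add: e)
      with y have "\<not> \<bar>Im (f y) - Im (f x)\<bar> < 2 * pi"
        using exp_complex_eqI by blast
      then show "2 * pi \<le> norm (f y - f x)"
        using abs_Im_le_cmod[of "f y - f x"] by simp
    qed simp
  qed (rule f)
  then show ?thesis
    using s t unfolding constant_on_def by metis
qed

text \<open>In the stereographic coordinate the antipodal map is \<open>z \<mapsto> - 1 / cnj z\<close>. If the paths did not meet
  up to sign, then \<open>A = 1 + cnj z * w\<close> and \<open>D = w - z\<close> would have no zero on the parameter square,
  and would have continuous logarithms \<open>\<alpha>\<close> and \<open>\<beta>\<close>. The values on opposite edges of the square are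
  related by the antipodal map, which turns \<open>A\<close> into a multiple of \<open>D\<close> and conversely, up to a sign
  and conjugation. Hence the four combinations \<open>k1\<close> to \<open>k4\<close> of logarithms on opposite edges are
  constant with exponential \<open>1\<close> or \<open>- 1\<close>, and going around the square in both ways gives incompatible
  signs. (The contradiction is the noncommutativity of the quaternions \<open>i\<close> and \<open>j\<close>.)\<close>

lemma odd_plane_paths_meet:
  fixes z w :: "real \<Rightarrow> complex"
  assumes z: "continuous_on {0..1} z" "z 0 \<noteq> 0" "cnj (z 0) * z 1 = -1"
    and w: "continuous_on {0..1} w" "w 0 \<noteq> 0" "cnj (w 0) * w 1 = -1"
  shows "\<exists>s\<in>{0..1}. \<exists>t\<in>{0..1}. w t = z s \<or> cnj (z s) * w t = -1"
proof (rule ccontr)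
  assume no: "\<not> ?thesis"
  define Q where "Q = {0..1::real} \<times> {0..1::real}"
  define A where "A = (\<lambda>p. 1 + cnj (z (fst p)) * w (snd p))"
  define D where "D = (\<lambda>p. w (snd p) - z (fst p))"
  have Q: "contractible Q"
    unfolding Q_def by (intro convex_imp_contractible convex_Times) auto
  have zc: "continuous_on Q (\<lambda>p. z (fst p))"
    using continuous_on_compose[OF continuous_on_fst[OF continuous_on_id], of Q z] z(1)
    by (auto simp: Q_def o_def elim: continuous_on_subset)
  have wc: "continuous_on Q (\<lambda>p. w (snd p))"
    using continuous_on_compose[OF continuous_on_snd[OF continuous_on_id], of Q w] w(1)
    by (auto simp: Q_def o_def elim: continuous_on_subset)
  have "continuous_on Q A" "continuous_on Q D"
    unfolding A_def D_def by (intro continuous_intros zc wc)+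
  moreover have "A p \<noteq> 0" "D p \<noteq> 0" if "p \<in> Q" for p
  proof -
    show "A p \<noteq> 0"
      using no that unfolding A_def Q_def
      by (metis add.commute add_eq_0_iff mem_Times_iff)
    show "D p \<noteq> 0"
      using no that unfolding D_def Q_def by (auto simp: mem_Times_iff)
  qed
  ultimately obtain \<alpha> \<beta>
    where \<alpha>: "continuous_on Q \<alpha>" "\<And>p. p \<in> Q \<Longrightarrow> A p = exp (\<alpha> p)"
      and \<beta>: "continuous_on Q \<beta>" "\<And>p. p \<in> Q \<Longrightarrow> D p = exp (\<beta> p)"
    using continuous_logarithm_on_contractible[OF _ Q, of A]
      continuous_logarithm_on_contractible[OF _ Q, of D] by metis
  obtain \<zeta> \<omega> where \<zeta>: "exp \<zeta> = z 0" and \<omega>: "exp \<omega> = w 0"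
    using z(2) w(2) exp_Ln by metis
  have z1: "z 1 = - 1 / cnj (z 0)" and w1: "w 1 = - 1 / cnj (w 0)"
    using z w by (auto simp: field_simps)
  have cv: "continuous_on {0..1} (\<lambda>t. \<phi> (c, t))" and ch: "continuous_on {0..1} (\<lambda>t. \<phi> (t, c))"
    if "continuous_on Q \<phi>" "c \<in> {0..1}" for \<phi> :: "real \<times> real \<Rightarrow> complex" and c
    by (rule continuous_on_compose2[OF that(1)], intro continuous_intros, use that(2) in \<open>auto simp: Q_def\<close>)+
  define k1 where "k1 = (\<lambda>t. \<alpha> (1, t) + \<zeta> - \<beta> (0, t))"
  define k2 where "k2 = (\<lambda>t. \<beta> (1, t) + cnj \<zeta> - \<alpha> (0, t))"
  define k3 where "k3 = (\<lambda>s. \<alpha> (s, 1) + cnj \<omega> - cnj (\<beta> (s, 0)))"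
  define k4 where "k4 = (\<lambda>s. \<beta> (s, 1) + cnj \<omega> - cnj (\<alpha> (s, 0)))"
  have q[simp]: "(s, t) \<in> Q \<longleftrightarrow> s \<in> {0..1} \<and> t \<in> {0..1}" for s t
    by (auto simp: Q_def)
  have A0: "A (s, t) \<noteq> 0" "D (s, t) \<noteq> 0" if "s \<in> {0..1}" "t \<in> {0..1}" for s t
    using that \<alpha>(2)[of "(s, t)"] \<beta>(2)[of "(s, t)"] by auto
  have e1: "exp (k1 t) = -1" if "t \<in> {0..1}" for t
  proof -
    have "exp (k1 t) = A (1, t) * z 0 / D (0, t)"
      using that \<alpha>(2)[of "(1, t)"] \<beta>(2)[of "(0, t)"] by (simp add: k1_def exp_add exp_diff \<zeta>)
    also have "A (1, t) * z 0 = - D (0, t)"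
      using z(2) by (simp add: A_def D_def z1 field_simps)
    finally show ?thesis
      using A0[of 0 t] that by simp
  qed
  have e2: "exp (k2 t) = 1" if "t \<in> {0..1}" for t
  proof -
    have "exp (k2 t) = D (1, t) * cnj (z 0) / A (0, t)"
      using that \<beta>(2)[of "(1, t)"] \<alpha>(2)[of "(0, t)"]
      by (simp add: k2_def exp_add exp_diff \<zeta> flip: exp_cnj)
    also have "D (1, t) * cnj (z 0) = A (0, t)"
      using z(2) by (simp add: A_def D_def z1 field_simps)
    finally show ?thesis
      using A0[of 0 t] that by simp
  qed
  have e3: "exp (k3 s) = 1" if "s \<in> {0..1}" for s
  proof -
    have "exp (k3 s) = A (s, 1) * cnj (w 0) / cnj (D (s, 0))"
      using that \<alpha>(2)[of "(s, 1)"] \<beta>(2)[of "(s, 0)"]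
      by (simp add: k3_def exp_add exp_diff \<omega> flip: exp_cnj)
    also have "A (s, 1) * cnj (w 0) = cnj (D (s, 0))"
      using w(2) by (simp add: A_def D_def w1 field_simps)
    finally show ?thesis
      using A0[of s 0] that by simp
  qed
  have e4: "exp (k4 s) = -1" if "s \<in> {0..1}" for s
  proof -
    have "exp (k4 s) = D (s, 1) * cnj (w 0) / cnj (A (s, 0))"
      using that \<beta>(2)[of "(s, 1)"] \<alpha>(2)[of "(s, 0)"]
      by (simp add: k4_def exp_add exp_diff \<omega> flip: exp_cnj)
    also have "D (s, 1) * cnj (w 0) = - cnj (A (s, 0))"
      using w(2) by (simp add: A_def D_def w1 field_simps)
    finally show ?thesis
      using A0[of s 0] that by simp
  qed
  have "continuous_on {0..1} k1" "continuous_on {0..1} k2"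
    "continuous_on {0..1} k3" "continuous_on {0..1} k4"
    unfolding k1_def k2_def k3_def k4_def
    by (intro continuous_intros cv[OF \<alpha>(1)] cv[OF \<beta>(1)] ch[OF \<alpha>(1)] ch[OF \<beta>(1)]; simp)+
  then have c: "k1 1 = k1 0" "k2 1 = k2 0" "k3 1 = k3 0" "k4 1 = k4 0"
    using e1 e2 e3 e4 by (auto intro: const_of_exp_const)
  have "Re (k1 0) = 0" "Re (k2 0) = 0"
    using e1[of 0] e2[of 0] norm_exp_eq_Re[of "k1 0"] norm_exp_eq_Re[of "k2 0"] by simp_all
  \<comment> \<open>The corner values \<open>\<alpha> (1, 1)\<close> and \<open>\<beta> (1, 1)\<close> are reached along two pairs of edges each.\<close>
  moreover have "k1 1 + k4 0 = k3 1 + cnj (k2 0)" "k2 1 + k3 0 = k4 1 + cnj (k1 0)"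
    by (simp_all add: k1_def k2_def k3_def k4_def)
  ultimately have "Re (k1 0) = - Re (k2 0)" "Im (k1 0) = - Im (k2 0)"
    unfolding c complex_eq_iff by simp_all
  then have "k1 0 = - k2 0"
    by (simp add: complex_eq_iff)
  then have "exp (k1 0) * exp (k2 0) = 1"
    by (simp flip: exp_add)
  then show False
    using e1[of 0] e2[of 0] by simp
qed

definition stereo :: "real^3 \<Rightarrow> complex" where
  "stereo x = Complex (x $ 1) (x $ 2) / of_real (1 - x $ 3)"

lemma norm_eq_1_vec3: "norm (x::real^3) = 1 \<longleftrightarrow> (x$1)\<^sup>2 + (x$2)\<^sup>2 + (x$3)\<^sup>2 = 1"
  by (simp add: norm_eq_1 inner_vec_def sum_3 power2_eq_square)

lemma stereo_inject:
  assumes "norm x = 1" "norm y = 1" "x $ 3 \<noteq> 1" "y $ 3 \<noteq> 1" "stereo x = stereo y"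
  shows "x = y"
proof -
  define c where "c = 1 - x $ 3"
  define d where "d = 1 - y $ 3"
  have cd: "c \<noteq> 0" "d \<noteq> 0" using assms by (auto simp: c_def d_def)
  have "x$1 / c = y$1 / d" "x$2 / c = y$2 / d"
    using assms(5) unfolding stereo_def c_def[symmetric] d_def[symmetric] complex_eq_iff
    by simp_all
  then have e: "x$1 = c / d * y$1" "x$2 = c / d * y$2"
    using cd by (auto simp: field_simps)
  have n: "(x$1)\<^sup>2 + (x$2)\<^sup>2 = c * (2 - c)" "(y$1)\<^sup>2 + (y$2)\<^sup>2 = d * (2 - d)"
    using assms(1,2) unfolding norm_eq_1_vec3 c_def d_def by (auto simp: power2_eq_square algebra_simps)
  have "c * (2 - c) = (c / d)\<^sup>2 * (d * (2 - d))"
    unfolding n[symmetric] e by (simp add: power_mult_distrib distrib_left power_divide)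
  then have "c = d"
    using cd by (simp add: field_simps power2_eq_square)
  then show ?thesis
    using e cd by (simp add: vec_eq_iff forall_3 c_def d_def)
qed

lemma stereo_antipode:
  assumes "norm x = 1" "x $ 3 \<noteq> 1" "x $ 3 \<noteq> -1"
  shows "cnj (stereo x) * stereo (- x) = -1"
proof -
  have s: "1 - x$3 \<noteq> 0" "1 + x$3 \<noteq> 0" using assms by auto
  have "(x$1)\<^sup>2 + (x$2)\<^sup>2 = (1 - x$3) * (1 + x$3)"
    using assms(1) unfolding norm_eq_1_vec3 by (auto simp: power2_eq_square algebra_simps)
  then have "cnj (Complex (x$1) (x$2)) * Complex (- x$1) (- x$2) = - of_real ((1 - x$3) * (1 + x$3))"
    by (auto simp: complex_eq_iff power2_eq_square)
  moreover have "cnj (stereo x) * stereo (- x)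
    = cnj (Complex (x$1) (x$2)) * Complex (- x$1) (- x$2) / of_real ((1 - x$3) * (1 + x$3))"
    by (simp add: stereo_def)
  ultimately show ?thesis
    using s by (metis divide_minus_left divide_self mult_eq_0_iff of_real_eq_0_iff)
qed

lemma odd_paths_meet_off_poles:
  fixes g h :: "real \<Rightarrow> real^3"
  assumes g: "path g" "path_image g \<subseteq> sphere 0 1" "pathfinish g = - pathstart g"
    and h: "path h" "path_image h \<subseteq> sphere 0 1" "pathfinish h = - pathstart h"
    and v: "\<And>x. x \<in> path_image g \<union> path_image h \<Longrightarrow> x $ 3 \<noteq> 1 \<and> x $ 3 \<noteq> - 1"
  shows "\<exists>x \<in> path_image g. x \<in> path_image h \<or> - x \<in> path_image h"
proof -
  have cont: "continuous_on {0..1} (stereo \<circ> p)"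
    if "path p" "\<And>x. x \<in> path_image p \<Longrightarrow> x $ 3 \<noteq> 1 \<and> x $ 3 \<noteq> - 1" for p
    using that unfolding path_def path_image_def stereo_def o_def Complex_eq
    by (auto intro!: continuous_intros)
  have an: "cnj (stereo x) * stereo (- x) = -1" if "x \<in> path_image g \<union> path_image h" for x
    using that g(2) h(2) v[OF that] by (auto intro!: stereo_antipode)
  have ends: "stereo (p 0) \<noteq> 0 \<and> cnj (stereo (p 0)) * stereo (p 1) = -1"
    if "p = g \<or> p = h" for p
  proof -
    have "p 0 \<in> path_image g \<union> path_image h"
      using that by (auto simp: path_image_def)
    moreover have "p 1 = - p 0"
      using that g(3) h(3) by (auto simp: pathstart_def pathfinish_def)
    ultimately show ?thesis
      using an by (metis complex_cnj_zero mult_zero_left neg_0_equal_iff_equal zero_neq_one)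
  qed
  obtain s t where st: "s \<in> {0..1}" "t \<in> {0..1}"
    "stereo (h t) = stereo (g s) \<or> cnj (stereo (g s)) * stereo (h t) = -1"
    using odd_plane_paths_meet[of "stereo \<circ> g" "stereo \<circ> h"] cont[OF g(1)] cont[OF h(1)] ends v
    by auto
  define x y where "x = g s" and "y = h t"
  have xy: "x \<in> path_image g" "y \<in> path_image h"
    using st by (auto simp: x_def y_def path_image_def)
  then have n: "norm x = 1" "norm y = 1"
    using g(2) h(2) by auto
  have v': "x $ 3 \<noteq> 1" "x $ 3 \<noteq> -1" "y $ 3 \<noteq> 1"
    using v xy by auto
  have "stereo y = stereo x \<or> stereo y = stereo (- x)"
    using st(3) an[of x] xy(1) unfolding x_def[symmetric] y_def[symmetric]
    by (metis UnI1 mult_cancel_left mult_zero_left neg_0_equal_iff_equal zero_neq_one)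
  then have "y = x \<or> y = - x"
    using stereo_inject[of y x] stereo_inject[of y "- x"] n v' by force
  then show ?thesis
    using xy by (intro bexI[of _ x]) auto
qed

text \<open>Read in the projective plane, these paths are noncontractible loops, and any two of those
  intersect. A rotation that moves \<open>v\<close> to the pole of the stereographic projection gives the general
  case.\<close>

lemma odd_paths_meet:
  fixes g h :: "real \<Rightarrow> real^3"
  assumes g: "path g" "path_image g \<subseteq> sphere 0 1" "pathfinish g = - pathstart g"
    and h: "path h" "path_image h \<subseteq> sphere 0 1" "pathfinish h = - pathstart h"
    and v: "norm v = 1" "{v, - v} \<inter> (path_image g \<union> path_image h) = {}"
  shows "\<exists>x \<in> path_image g. x \<in> path_image h \<or> - x \<in> path_image h"
proof -
  obtain f where f: "orthogonal_transformation f" and fv: "f v = (axis 3 1 :: real^3)"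
    by (rule orthogonal_transformation_exists[of v "axis 3 1"]) (simp_all add: v(1))
  have lin: "linear f" and inj: "inj f"
    by (fact orthogonal_transformation_linear[OF f], fact orthogonal_transformation_inj[OF f])
  have fm: "f (- x) = - f x" and fn: "norm (f x) = norm x" for x
    by (fact linear_neg[OF lin], fact orthogonal_transformation_norm[OF f])
  have pole: "f x $ 3 \<noteq> 1 \<and> f x $ 3 \<noteq> - 1" if "x \<in> path_image g \<union> path_image h" for x
  proof -
    have n: "norm (f x) = 1" using that g(2) h(2) fn by auto
    have "f x = f v \<or> f x = f (- v)" if "f x $ 3 = 1 \<or> f x $ 3 = - 1"
    proof -
      have "(f x $ 3)\<^sup>2 = 1" using that by auto
      then have "(f x $ 1)\<^sup>2 + (f x $ 2)\<^sup>2 = 0"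
        using n unfolding norm_eq_1_vec3 by linarith
      then have "f x $ 1 = 0" "f x $ 2 = 0"
        by (simp_all add: sum_power2_eq_zero_iff)
      then show ?thesis
        unfolding fm fv using that by (simp add: vec_eq_iff forall_3 axis_def)
    qed
    then have "f x $ 3 = 1 \<or> f x $ 3 = - 1 \<Longrightarrow> x = v \<or> x = - v"
      using inj unfolding inj_def by metis
    then show ?thesis
      using that v(2) by blast
  qed
  have cf: "continuous_on X f" for X
    using lin by (simp add: linear_continuous_on linear_conv_bounded_linear)
  have "\<exists>x \<in> path_image (f \<circ> g). x \<in> path_image (f \<circ> h) \<or> - x \<in> path_image (f \<circ> h)"
  proof (rule odd_paths_meet_off_poles)
    show "path (f \<circ> g)" "path (f \<circ> h)"
      by (rule path_continuous_image[OF g(1) cf], rule path_continuous_image[OF h(1) cf])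
    show "path_image (f \<circ> g) \<subseteq> sphere 0 1" "path_image (f \<circ> h) \<subseteq> sphere 0 1"
      using g(2) h(2) by (auto simp: path_image_compose subset_iff fn)
    show "pathfinish (f \<circ> g) = - pathstart (f \<circ> g)" "pathfinish (f \<circ> h) = - pathstart (f \<circ> h)"
      by (simp_all add: pathstart_compose pathfinish_compose g(3) h(3) fm)
    show "x $ 3 \<noteq> 1 \<and> x $ 3 \<noteq> - 1" if "x \<in> path_image (f \<circ> g) \<union> path_image (f \<circ> h)" for x
      using that pole by (auto simp: path_image_compose)
  qed
  then obtain x where x: "x \<in> path_image (f \<circ> g)" "x \<in> path_image (f \<circ> h) \<or> - x \<in> path_image (f \<circ> h)"
    by blast
  then obtain y where y: "x = f y" "y \<in> path_image g"
    by (auto simp: path_image_compose)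
  with x have "f y \<in> f ` path_image h \<or> f (- y) \<in> f ` path_image h"
    by (simp add: path_image_compose fm)
  then have "y \<in> path_image h \<or> - y \<in> path_image h"
    using inj by (simp add: inj_image_mem_iff)
  with y show ?thesis by blast
qed

section \<open>Plane topology on the sphere\<close>

text \<open>A constant rather than an abbreviation, in order that simplification does not turn membership into
  an equation between norms.\<close>

definition S2 :: "(real^3) set" where "S2 = sphere 0 1"

lemma mem_S2: "x \<in> S2 \<longleftrightarrow> norm x = 1"
  by (simp add: S2_def)

lemma minus_mem_S2 [simp]: "- x \<in> S2 \<longleftrightarrow> x \<in> S2"
  by (simp add: mem_S2)

lemma compact_S2: "compact S2" and connected_S2: "connected S2" and closed_S2: "closed S2"
  and locally_connected_S2: "locally connected S2"
  and locally_path_connected_S2: "locally path_connected S2"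
  by (simp_all add: S2_def connected_sphere locally_connected_sphere locally_path_connected_sphere)

lemma S2_neq_uminus: "x \<in> S2 \<Longrightarrow> - x \<noteq> x"
  by (metis add.right_inverse mem_S2 norm_zero scaleR_2 scaleR_eq_0_iff zero_neq_numeral zero_neq_one)

lemma punctured_sphere_plane:
  assumes "p \<in> S2"
  obtains h k where "homeomorphism (S2 - {p}) (UNIV :: complex set) h k"
proof -
  have "p \<noteq> 0" using assms by (auto simp: mem_S2)
  have "S2 - {p} homeomorphic {x. p \<bullet> x = 0}"
    unfolding S2_def
    by (rule homeomorphic_punctured_sphere_affine)
       (use assms[unfolded S2_def] \<open>p \<noteq> 0\<close> in \<open>auto simp: affine_hyperplane aff_dim_hyperplane\<close>)
  moreover have "{x. p \<bullet> x = 0} homeomorphic (UNIV :: complex set)"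
    by (rule homeomorphic_affine_sets)
       (use \<open>p \<noteq> 0\<close> in \<open>auto simp: affine_hyperplane aff_dim_hyperplane\<close>)
  ultimately show ?thesis
    using that homeomorphic_trans unfolding homeomorphic_def by metis
qed

text \<open>Projecting from \<open>p\<close> turns \<open>C\<close> into a compact set and \<open>T\<close> into a closed, possibly unbounded, set
  of the plane, which is the generality of Janiszewski's theorem there. The connected sets \<open>A\<close> and \<open>B\<close>
  witness that neither \<open>C\<close> nor \<open>T\<close> separates \<open>a\<close> from \<open>b\<close>, and \<open>X\<close> that their union does not.\<close>

lemma sphere_Janiszewski:
  assumes C: "compact C" "C \<subseteq> S2" and T: "closed T" "T \<subseteq> S2" and p: "p \<in> T" "p \<notin> C"
    and CT: "connected (C \<inter> T)"
    and A: "connected A" "A \<subseteq> S2 - C" "p \<notin> A" "a \<in> A" "b \<in> A"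
    and B: "connected B" "B \<subseteq> S2 - T" "a \<in> B" "b \<in> B"
  obtains X where "connected X" "X \<subseteq> S2 - C - T" "a \<in> X" "b \<in> X"
proof -
  obtain h k where hk: "homeomorphism (S2 - {p}) (UNIV :: complex set) h k"
    using punctured_sphere_plane p(1) T(2) by blast
  have kh: "k (h x) = x" if "x \<in> S2" "x \<noteq> p" for x
    using hk that by (auto simp: homeomorphism_def)
  have hk': "h (k y) = y" and kin: "k y \<in> S2 - {p}" for y
    using hk unfolding homeomorphism_def by blast+
  have conth: "continuous_on Y h" if "Y \<subseteq> S2 - {p}" for Y
    using hk that continuous_on_subset by (auto simp: homeomorphism_def)
  have contk: "continuous_on Y k" for Y
    using hk continuous_on_subset by (auto simp: homeomorphism_def)
  have inj: "x = y" if "h x = h y" "x \<in> S2" "x \<noteq> p" "y \<in> S2" "y \<noteq> p" for x y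
    using that kh by metis
  have "connected_component (- (h ` C \<union> h ` (T - {p}))) (h a) (h b)"
  proof (rule Janiszewski)
    show "compact (h ` C)"
      using C p by (intro compact_continuous_image conth) auto
    have "closedin (top_of_set (S2 - {p})) (T - {p})"
      using T by (auto simp: closedin_closed)
    then show "closed (h ` (T - {p}))"
      using homeomorphism_imp_closed_map[OF hk] by simp
    have "h ` C \<inter> h ` (T - {p}) = h ` (C \<inter> T)"
      using C(2) T(2) p inj by fast
    then show "connected (h ` C \<inter> h ` (T - {p}))"
      using C p CT by (simp only:) (intro connected_continuous_image conth; auto)
    show "connected_component (- (h ` C)) (h a) (h b)"
      unfolding connected_component_def
    proof (intro exI[of _ "h ` A"] conjI)
      show "connected (h ` A)"
        using A by (intro connected_continuous_image conth) auto
      show "h ` A \<subseteq> - h ` C"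
        using A C p inj by fast
    qed (use A in auto)
    show "connected_component (- (h ` (T - {p}))) (h a) (h b)"
      unfolding connected_component_def
    proof (intro exI[of _ "h ` B"] conjI)
      show "connected (h ` B)"
        using B p by (intro connected_continuous_image conth) auto
      show "h ` B \<subseteq> - h ` (T - {p})"
        using B T p inj by fast
    qed (use B in auto)
  qed
  then obtain Y where Y: "connected Y" "Y \<subseteq> - (h ` C \<union> h ` (T - {p}))" "h a \<in> Y" "h b \<in> Y"
    unfolding connected_component_def by blast
  have ab: "k (h a) = a" "k (h b) = b"
    using A kh by auto
  show thesis
  proof
    show "connected (k ` Y)"
      using Y(1) contk connected_continuous_image by blast
    show "a \<in> k ` Y" "b \<in> k ` Y"
      using Y ab by force+
    show "k ` Y \<subseteq> S2 - C - T"
    proof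
      fix x assume "x \<in> k ` Y"
      then obtain y where y: "y \<in> Y" "x = k y" by blast
      then have "h x \<notin> h ` C" "h x \<notin> h ` (T - {p})"
        using Y(2) hk' by auto
      then show "x \<in> S2 - C - T"
        using kin[of y] y by blast
    qed
  qed
qed

text \<open>From a point \<open>p\<close> outside, \<open>W\<close> projects to an open subset of the plane, where the corresponding
  fact is known.\<close>

lemma connected_sphere_delete_finite:
  assumes W: "openin (top_of_set S2) W" "connected W" and p: "p \<in> S2" "p \<notin> W" and F: "finite F"
  shows "connected (W - F)"
proof -
  obtain h k where hk: "homeomorphism (S2 - {p}) (UNIV :: complex set) h k"
    using punctured_sphere_plane p(1) by blast
  have sub: "W \<subseteq> S2 - {p}"
    using W p openin_imp_subset by fastforce
  have kh: "k (h x) = x" if "x \<in> W" for x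
    using hk that sub by (auto simp: homeomorphism_def)
  have "open (h ` W)"
    using homeomorphism_imp_open_map[OF hk, of W] openin_subset_trans[OF W(1) sub] by auto
  moreover have "connected (h ` W)"
    using W(2) hk sub
    by (auto simp: homeomorphism_def intro!: connected_continuous_image elim: continuous_on_subset)
  ultimately have "connected (h ` W - h ` (W \<inter> F))"
    using F by (intro connected_open_diff_countable) (auto intro: countable_finite)
  then have "connected (k ` (h ` W - h ` (W \<inter> F)))"
    using hk by (auto simp: homeomorphism_def intro!: connected_continuous_image elim: continuous_on_subset)
  moreover have "k ` (h ` W - h ` (W \<inter> F)) = W - F"
  proof
    show "k ` (h ` W - h ` (W \<inter> F)) \<subseteq> W - F"
      using kh by (fastforce simp: image_subset_iff)
    show "W - F \<subseteq> k ` (h ` W - h ` (W \<inter> F))"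
    proof
      fix x assume x: "x \<in> W - F"
      have "h x \<noteq> h y" if "y \<in> W \<inter> F" for y
      proof
        assume "h x = h y"
        then have "k (h x) = k (h y)" by simp
        with x that show False using kh[of x] kh[of y] by auto
      qed
      then have "h x \<notin> h ` (W \<inter> F)" by blast
      then show "x \<in> k ` (h ` W - h ` (W \<inter> F))"
        using x kh[of x] by (intro image_eqI[of _ _ "h x"]) auto
    qed
  qed
  ultimately show ?thesis by simp
qed

lemma connected_openin_sphere_diff_finite:
  assumes W: "openin (top_of_set S2) W" "connected W" and F: "finite F"
  shows "connected (W - F)"
proof -
  consider "S2 - W \<noteq> {}" | "W - F = W" | p where "W = S2" "p \<in> F" "p \<in> S2"
    using openin_imp_subset[OF W(1)] by blast
  then show ?thesis
  proof cases
    case 1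
    then show ?thesis using connected_sphere_delete_finite[OF W _ _ F] by blast
  next
    case 2
    then show ?thesis using W(2) by simp
  next
    case (3 p)
    obtain h k where hk: "homeomorphism (S2 - {p}) (UNIV :: complex set) h k"
      using punctured_sphere_plane[OF 3(3)] .
    then have "continuous_on UNIV k" "k ` UNIV = S2 - {p}"
      by (simp_all add: homeomorphism_def)
    then have "connected (S2 - {p})"
      by (metis connected_UNIV connected_continuous_image)
    moreover have "openin (top_of_set S2) (S2 - {p})"
      by (simp add: Diff_eq openin_open_Int open_Compl)
    ultimately have "connected (S2 - {p} - F)"
      using connected_sphere_delete_finite[of "S2 - {p}" p F] 3(3) F by blast
    moreover have "S2 - {p} - F = W - F" using 3 by blast
    ultimately show ?thesis by simp
  qed
qed

definition side :: "(real^3) set \<Rightarrow> real^3 \<Rightarrow> (real^3) set" where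
  "side C a = connected_component_set (S2 - C) a"

lemma openin_side: "closed C \<Longrightarrow> openin (top_of_set S2) (side C a)"
proof -
  assume "closed C"
  then have "openin (top_of_set S2) (S2 - C)"
    by (simp add: Diff_eq openin_open_Int open_Compl)
  then show ?thesis
    unfolding side_def
    using openin_trans locally_connected_S2
    by (metis locally_open_subset openin_connected_component_locally_connected)
qed

lemma connected_side: "connected (side C a)"
  by (simp add: side_def)

lemma side_subset: "side C a \<subseteq> S2 - C"
  by (simp add: side_def connected_component_subset)

lemma side_refl: "a \<in> S2 \<Longrightarrow> a \<notin> C \<Longrightarrow> a \<in> side C a"
  by (simp add: side_def)

lemma side_maximal: "connected X \<Longrightarrow> a \<in> X \<Longrightarrow> X \<subseteq> S2 \<Longrightarrow> X \<inter> C = {} \<Longrightarrow> X \<subseteq> side C a"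
  unfolding side_def by (rule connected_component_maximal) auto

lemma side_eq: "b \<in> side C a \<Longrightarrow> side C b = side C a"
  unfolding side_def using connected_component_eq by blast

text \<open>The plane curve theorem, transported by projecting from \<open>a\<close>: the domain \<open>V\<close> corresponds to the
  inside of the plane curve, and the side of \<open>a\<close> to its outside together with the point at infinity.\<close>

lemma sphere_Jordan:
  assumes c: "simple_path c" "pathfinish c = pathstart c" "path_image c \<subseteq> S2"
    and a: "a \<in> S2" "a \<notin> path_image c"
  obtains V where "connected V" "V \<noteq> {}" "openin (top_of_set S2) V"
    "S2 - path_image c = side (path_image c) a \<union> V" "side (path_image c) a \<inter> V = {}"
    "path_image c \<subseteq> closure (side (path_image c) a)" "path_image c \<subseteq> closure V"
proof -
  define C where "C = path_image c"
  define W where "W = side C a"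
  have comp: "compact C" and clC: "closed C"
    using c by (auto simp: C_def compact_path_image compact_imp_closed simple_path_imp_path)
  have aC: "a \<notin> C" "C \<subseteq> S2" and aW: "a \<in> W"
    using a c by (auto simp: C_def W_def side_refl)
  have opW: "openin (top_of_set S2) W" and conW: "connected W" and subW: "W \<subseteq> S2 - C"
    unfolding W_def using openin_side[OF clC] connected_side side_subset by auto
  obtain h k where hk: "homeomorphism (S2 - {a}) (UNIV :: complex set) h k"
    using punctured_sphere_plane a(1) by blast
  have kh: "k (h x) = x" if "x \<in> S2" "x \<noteq> a" for x
    using hk that by (auto simp: homeomorphism_def)
  have hk': "h (k y) = y" and kin: "k y \<in> S2 - {a}" for y
    using hk unfolding homeomorphism_def by blast+
  have conth: "continuous_on Y h" if "Y \<subseteq> S2 - {a}" for Y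
    using hk that continuous_on_subset by (auto simp: homeomorphism_def)
  have contk: "continuous_on Y k" for Y
    using hk continuous_on_subset by (auto simp: homeomorphism_def)
  have CS: "C \<subseteq> S2 - {a}"
    using aC by auto
  have inj: "inj_on h C"
    using kh CS by (intro inj_on_inverseI[of _ k]) auto
  have "simple_path (h \<circ> c)"
    by (rule simple_path_continuous_image[OF c(1)]) (use conth[OF CS] inj in \<open>auto simp: C_def\<close>)
  moreover have "pathfinish (h \<circ> c) = pathstart (h \<circ> c)"
    using c by (simp add: pathfinish_compose pathstart_compose)
  ultimately obtain I J where
    I: "I \<noteq> {}" "open I" "connected I" "bounded I" "frontier I = h ` C" and
    J: "J \<noteq> {}" "open J" "connected J" "\<not> bounded J" "frontier J = h ` C" and
    IJ: "I \<inter> J = {}" "I \<union> J = - (h ` C)"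
    using Jordan_curve[of "h \<circ> c"] unfolding path_image_compose C_def by metis
  \<comment> \<open>If the projected component of \<open>a\<close> were inside, then the unbounded \<open>J\<close> would lie in the compact
    image of the complement of \<open>W\<close>.\<close>
  have pJ: "W - {a} \<subseteq> k ` J"
  proof -
    obtain q where q: "q \<in> C"
      using c by (metis C_def pathstart_in_path_image)
    have "connected (W - {a})"
      using connected_sphere_delete_finite[OF opW conW, of q "{a}"] q subW CS by auto
    then have con: "connected (h ` (W - {a}))"
      using subW by (intro connected_continuous_image conth) auto
    have sub: "h ` (W - {a}) \<subseteq> I \<union> J"
    proof -
      have "h x \<notin> h ` C" if "x \<in> W - {a}" for x
      proof
        assume "h x \<in> h ` C"
        then obtain y where "y \<in> C" "h x = h y" by auto
        then have "k (h x) = k (h y)" by simp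
        moreover have "x \<in> S2 - {a}" "y \<in> S2 - {a}" using that subW \<open>y \<in> C\<close> CS by blast+
        ultimately have "x = y" using kh by simp
        then show False using \<open>y \<in> C\<close> that subW by auto
      qed
      then show ?thesis using IJ by auto
    qed
    have "\<not> h ` (W - {a}) \<subseteq> I"
    proof
      assume asm: "h ` (W - {a}) \<subseteq> I"
      have "J \<subseteq> h ` (S2 - W)"
      proof
        fix y assume "y \<in> J"
        then have "k y \<notin> W"
          using asm IJ(1) hk' kin by (metis Diff_iff disjoint_iff image_eqI subsetD)
        then show "y \<in> h ` (S2 - W)"
          using kin hk' by (metis DiffD1 DiffI image_eqI)
      qed
      moreover have "compact (S2 - W)"
      proof -
        obtain O' where "open O'" "W = S2 \<inter> O'"
          using opW by (auto simp: openin_open)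
        then have "S2 - W = S2 \<inter> - O'" by auto
        then show ?thesis using \<open>open O'\<close> by (simp add: compact_Int_closed closed_Compl compact_S2)
      qed
      then have "compact (h ` (S2 - W))"
        using aW by (intro compact_continuous_image conth) auto
      ultimately show False
        using J(4) bounded_subset compact_imp_bounded by blast
    qed
    then have "h ` (W - {a}) \<subseteq> J"
      using connectedD[OF con I(2) J(2)] sub IJ(1) by blast
    then have "k ` h ` (W - {a}) \<subseteq> k ` J" by blast
    moreover have "k ` h ` (W - {a}) = W - {a}"
    proof -
      have "k (h x) = x" if "x \<in> W - {a}" for x
        using that subW by (intro kh) auto
      then show ?thesis by (simp add: image_image)
    qed
    ultimately show ?thesis by simp
  qed
  have khC: "k (h x) = x" if "x \<in> C" for x
    using that CS kh by blast
  have kC: "k y \<in> C \<longleftrightarrow> y \<in> h ` C" for y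
  proof
    assume "k y \<in> C"
    then have "h (k y) \<in> h ` C" by blast
    then show "y \<in> h ` C" by (simp add: hk')
  qed (auto simp: khC)
  have "W \<noteq> {a}"
  proof
    assume "W = {a}"
    then have "openin (top_of_set S2) {a}"
      using opW by (simp only:)
    moreover have "closedin (top_of_set S2) {a}"
      by (rule closed_subset) (use a(1) in blast, rule closed_singleton)
    ultimately have "openin (top_of_set S2) {a} \<and> closedin (top_of_set S2) {a}" ..
    then have "{a} = {} \<or> {a} = S2"
      by (rule connected_S2[unfolded connected_clopen, rule_format])
    then show False
      using kin[of 0] by blast
  qed
  then obtain x where x: "x \<in> W - {a}" using aW by blast
  have kJ: "k ` J \<subseteq> W"
    unfolding W_def
  proof -
    have "x \<in> k ` J" using x pJ by auto
    moreover have "k ` J \<inter> C = {}" using kC IJ by auto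
    ultimately have "k ` J \<subseteq> side C x"
      using kin J(3) by (intro side_maximal connected_continuous_image contk) auto
    then show "k ` J \<subseteq> side C a"
      using side_eq[of x C a] x by (simp add: W_def)
  qed
  have Weq: "W = insert a (k ` J)"
    using pJ kJ aW by auto
  have clo: "C \<subseteq> closure (k ` X)" if "frontier X = h ` C" for X
  proof -
    have "h ` C \<subseteq> closure X" using that by (auto simp: frontier_def)
    moreover have "k ` closure X \<subseteq> closure (k ` X)"
      by (rule image_closure_subset) (use contk closure_subset[of "k ` X"] in auto)
    ultimately have "k ` h ` C \<subseteq> closure (k ` X)" by blast
    moreover have "k ` h ` C = C" using khC by (simp add: image_image)
    ultimately show ?thesis by simp
  qed
  show thesis
  proof (rule that[of "k ` I", folded C_def, folded W_def])
    show "connected (k ` I)" using I contk connected_continuous_image by blast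
    show "k ` I \<noteq> {}" using I by auto
    have "openin (top_of_set (S2 - {a})) (k ` I)"
      using homeomorphism_imp_open_map[OF homeomorphism_symD[OF hk], of I] I by auto
    moreover have "openin (top_of_set S2) (S2 - {a})"
      by (simp add: Diff_eq openin_open_Int open_Compl)
    ultimately show "openin (top_of_set S2) (k ` I)" using openin_trans by blast
    show "W \<inter> k ` I = {}"
    proof -
      have "inj k" using hk' by (rule inj_on_inverseI)
      then have "k ` J \<inter> k ` I = {}"
        using IJ(1) image_Int[of k J I] by (simp add: Int_commute)
      moreover have "a \<notin> k ` I" using kin by auto
      ultimately show ?thesis unfolding Weq by blast
    qed
    show "S2 - C = W \<union> k ` I"
    proof
      show "S2 - C \<subseteq> W \<union> k ` I"
      proof
        fix y assume y: "y \<in> S2 - C"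
        show "y \<in> W \<union> k ` I"
        proof (cases "y = a")
          case False
          then have "y = k (h y)" "h y \<notin> h ` C"
            using y kh kC[of "h y"] by auto
          then show ?thesis unfolding Weq using IJ(2) by blast
        qed (use aW in auto)
      qed
      show "W \<union> k ` I \<subseteq> S2 - C"
      proof -
        have "k y \<in> S2 - C" if "y \<in> I" for y
        proof -
          have "y \<notin> h ` C" using that IJ(2) by blast
          then show ?thesis using kin[of y] kC[of y] by blast
        qed
        then show ?thesis using subW by blast
      qed
    qed
    show "C \<subseteq> closure W" using clo[OF J(5)] kJ closure_mono by blast
    show "C \<subseteq> closure (k ` I)" using clo[OF I(5)] .
  qed
qed

section \<open>Antipodally symmetric simple closed curves\<close>

text \<open>These are the preimages of the noncontractible simple closed curves in the projective plane: half
  of the curve is an arc \<open>g\<close> from a point to its antipode, and the antipodal map sends it to the other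
  half.\<close>

definition antipodal_curve :: "(real^3) set \<Rightarrow> bool" where
  "antipodal_curve C \<longleftrightarrow> (\<exists>g. arc g \<and> pathfinish g = - pathstart g \<and> path_image g \<subseteq> S2 \<and>
     path_image g \<inter> uminus ` path_image g = {pathstart g, pathfinish g} \<and>
     C = path_image g \<union> uminus ` path_image g)"

lemma antipodal_curve_uminus: "antipodal_curve C \<Longrightarrow> - x \<in> C \<longleftrightarrow> x \<in> C"
proof -
  assume "antipodal_curve C"
  then obtain P where P: "C = P \<union> uminus ` P"
    unfolding antipodal_curve_def by blast
  have "y \<in> uminus ` P \<longleftrightarrow> - y \<in> P" for y
    by (metis image_iff minus_minus)
  then show ?thesis
    unfolding P Un_iff by (simp add: disj_commute)
qed

lemma antipodal_curve_subset: "antipodal_curve C \<Longrightarrow> C \<subseteq> S2"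
proof -
  assume "antipodal_curve C"
  then obtain P where P: "C = P \<union> uminus ` P" "P \<subseteq> S2"
    unfolding antipodal_curve_def by blast
  then show ?thesis by auto
qed

lemma antipodal_curve_simple_loop:
  assumes "antipodal_curve C"
  obtains c where "simple_path c" "pathfinish c = pathstart c" "path_image c = C"
proof -
  obtain g where g: "arc g" "pathfinish g = - pathstart g"
    "path_image g \<inter> uminus ` path_image g = {pathstart g, pathfinish g}"
    "C = path_image g \<union> uminus ` path_image g"
    using assms unfolding antipodal_curve_def by blast
  have m: "arc (uminus \<circ> g)"
    using g(1) unfolding arc_def
    by (auto intro!: path_continuous_image continuous_intros simp: inj_on_def)
  have "simple_path (g +++ (uminus \<circ> g))"
    by (rule simple_path_join_loop[OF g(1) m])
       (use g in \<open>auto simp: pathfinish_compose pathstart_compose path_image_compose\<close>)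
  then show thesis
    by (rule that) (use g in \<open>simp_all add: pathfinish_compose path_image_compose path_image_join pathstart_compose\<close>)
qed

lemma antipodal_curve_compact: "antipodal_curve C \<Longrightarrow> compact C"
  using antipodal_curve_simple_loop compact_path_image simple_path_imp_path by metis

lemma antipodal_curve_closed: "antipodal_curve C \<Longrightarrow> closed C"
  by (simp add: antipodal_curve_compact compact_imp_closed)

lemma side_uminus:
  assumes C: "\<And>x. - x \<in> C \<longleftrightarrow> x \<in> C" and a: "a \<in> S2" "a \<notin> C"
  shows "side C (- a) = uminus ` side C a"
proof -
  have sub: "uminus ` side C b \<subseteq> side C (- b)" if "b \<in> S2" "b \<notin> C" for b
  proof (rule side_maximal)
    show "connected (uminus ` side C b)"
      by (intro connected_continuous_image connected_side continuous_intros)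
    show "- b \<in> uminus ` side C b" using that side_refl by auto
    show "uminus ` side C b \<subseteq> S2" "uminus ` side C b \<inter> C = {}"
      using side_subset[of C b] C by auto
  qed
  have "uminus ` side C (- a) \<subseteq> side C a"
    using sub[of "- a"] a C by simp
  then have "uminus ` uminus ` side C (- a) \<subseteq> uminus ` side C a"
    by (rule image_mono)
  then show ?thesis
    using sub[OF a] by (simp add: image_image)
qed

text \<open>If \<open>a\<close> and \<open>- a\<close> were on the same side, then this side would be invariant under the antipodal map,
  and so would the other one. A path from \<open>a\<close> to \<open>- a\<close> in the first side would meet the half \<open>g\<close> of \<open>C\<close>
  up to sign. As a point \<open>v\<close> missed by both paths together with \<open>- v\<close>, any point of the other side
  will do.\<close>

lemma antipode_not_in_side:
  assumes C: "antipodal_curve C" and a: "a \<in> S2" "a \<notin> C"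
  shows "- a \<notin> side C a"
proof
  assume asm: "- a \<in> side C a"
  have um: "side C (- a) = uminus ` side C a"
    using side_uminus antipodal_curve_uminus[OF C] a by blast
  have sym: "uminus ` side C a = side C a"
    using side_eq[OF asm] um by simp
  obtain c where c: "simple_path c" "pathfinish c = pathstart c" "path_image c = C"
    using antipodal_curve_simple_loop[OF C] .
  then obtain V where V: "V \<noteq> {}" "S2 - C = side C a \<union> V" "side C a \<inter> V = {}"
    using sphere_Jordan[of c a] a antipodal_curve_subset[OF C] by metis
  then obtain v where v: "v \<in> V" by blast
  have vS: "v \<in> S2" and v': "v \<notin> side C a \<union> C" using v V by auto
  have v'': "- v \<notin> side C a \<union> C"
    using v' sym antipodal_curve_uminus[OF C, of v] by (metis UnCI UnE imageI minus_minus)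
  have "path_component (side C a) a (- a)"
  proof -
    have "locally path_connected (side C a)"
      using locally_open_subset[OF locally_path_connected_S2 openin_side[OF antipodal_curve_closed[OF C]]] .
    then have "path_component (side C a) a = connected_component (side C a) a"
      by (rule path_component_eq_connected_component)
    moreover have "connected_component (side C a) a (- a)"
      unfolding connected_component_def using asm connected_side side_refl[OF a] by blast
    ultimately show ?thesis by simp
  qed
  then obtain h where h: "path h" "path_image h \<subseteq> side C a" "pathstart h = a" "pathfinish h = - a"
    unfolding path_component_def by blast
  obtain g where g: "arc g" "pathfinish g = - pathstart g" "path_image g \<subseteq> S2" "path_image g \<subseteq> C"
    using C unfolding antipodal_curve_def by blast
  have "\<exists>x \<in> path_image g. x \<in> path_image h \<or> - x \<in> path_image h"
  proof (rule odd_paths_meet)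
    show "path g" using g arc_imp_path by blast
    show "path_image g \<subseteq> sphere 0 1" using g(3) unfolding S2_def .
    show "path_image h \<subseteq> sphere 0 1" using h(2) side_subset[of C a] unfolding S2_def by blast
    show "{v, - v} \<inter> (path_image g \<union> path_image h) = {}"
      using v' v'' g(4) h(2) by blast
    show "norm v = 1" using vS by (simp add: mem_S2)
  qed (use g h in auto)
  then show False
    using g(4) h(2) side_subset[of C a] antipodal_curve_uminus[OF C] by blast
qed

lemma sides_of_antipodal_curve:
  assumes C: "antipodal_curve C" and a: "a \<in> S2" "a \<notin> C"
  shows "S2 - C = side C a \<union> side C (- a)" (is ?un)
    and "side C a \<inter> side C (- a) = {}" (is ?disj)
    and "C \<subseteq> closure (side C a)" (is ?cl)
proof -
  obtain c where c: "simple_path c" "pathfinish c = pathstart c" "path_image c = C"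
    using antipodal_curve_simple_loop[OF C] .
  then obtain V where V: "connected V" "V \<noteq> {}" "S2 - C = side C a \<union> V" "side C a \<inter> V = {}"
    "C \<subseteq> closure (side C a)"
    using sphere_Jordan[of c a] a antipodal_curve_subset[OF C] by metis
  have "- a \<in> S2 - C" using a antipodal_curve_uminus[OF C] by simp
  then have aV: "- a \<in> V" using V(3) antipode_not_in_side[OF C a] by blast
  then have VS: "V \<subseteq> side C (- a)"
    using V by (intro side_maximal) auto
  have disj: "side C a \<inter> side C (- a) = {}"
  proof (rule ccontr)
    assume "side C a \<inter> side C (- a) \<noteq> {}"
    then have "side C a = side C (- a)" using side_eq by blast
    then show False using VS aV V(4) by blast
  qed
  then have "V = side C (- a)" using VS V(3) side_subset[of C "- a"] by blast
  then show ?un ?disj ?cl using V disj by auto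
qed

lemma side_cases:
  assumes "antipodal_curve C" "a \<in> S2" "a \<notin> C" "b \<in> S2" "b \<notin> C"
  shows "side C b = side C a \<or> side C b = side C (- a)"
  using sides_of_antipodal_curve(1)[OF assms(1-3)] assms(4,5) side_eq[of b C] by blast

text \<open>A half with end points \<open>x\<close> and \<open>- x\<close> is obtained from the defining arc \<open>g\<close> by moving its starting
  point to \<open>x\<close> or \<open>- x\<close>, say \<open>g t\<close>: follow \<open>g\<close> from \<open>g t\<close> to its end, then \<open>- g\<close> until \<open>- g t\<close>. The case where \<open>x\<close> is an end
  point of \<open>g\<close> is separate, since then one of the two pieces would be reduced to an end point.\<close>

lemma antipodal_curve_halves:
  assumes C: "antipodal_curve C" and x: "x \<in> C"
  obtains H where "connected H" "H \<noteq> {}" "C = {x, - x} \<union> H \<union> uminus ` H" "H \<inter> {x, - x} = {}"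
    "{x, - x} \<subseteq> closure H"
proof -
  obtain g where g: "arc g" "pathfinish g = - pathstart g" "path_image g \<subseteq> S2"
    "path_image g \<inter> uminus ` path_image g = {pathstart g, pathfinish g}"
    "C = path_image g \<union> uminus ` path_image g"
    using C unfolding antipodal_curve_def by blast
  have g1: "g 1 = - g 0" using g(2) by (simp add: pathstart_def pathfinish_def)
  have cont: "continuous_on {0..1} g" using g(1) by (simp add: arc_def path_def)
  have inj: "s = t" if "g s = g t" "s \<in> {0..1}" "t \<in> {0..1}" for s t
    using g(1) that by (auto simp: arc_def inj_on_def)
  have opp: "s \<in> {0, 1} \<and> t \<in> {0, 1}" if "g s = - g t" "s \<in> {0..1}" "t \<in> {0..1}" for s t
  proof -
    have "g s \<in> path_image g \<inter> uminus ` path_image g" "g t \<in> path_image g \<inter> uminus ` path_image g"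
    proof -
      have "g s \<in> path_image g" "g t \<in> path_image g"
        using that(2,3) unfolding path_image_def by blast+
      moreover have "g t = - g s" using that by simp
      ultimately show "g s \<in> path_image g \<inter> uminus ` path_image g"
        "g t \<in> path_image g \<inter> uminus ` path_image g"
        using that(1) by blast+
    qed
    then have "g s \<in> {g 0, g 1}" "g t \<in> {g 0, g 1}"
      unfolding g(4) by (auto simp: pathstart_def pathfinish_def)
    then show ?thesis
      using inj[of s 0] inj[of s 1] inj[of t 0] inj[of t 1] that(2,3) by auto
  qed
  obtain t where t: "t \<in> {0..1}" "{x, - x} = {g t, - g t}"
  proof -
    obtain y where y: "y \<in> path_image g" "x = y \<or> x = - y" using x g(5) by auto
    then obtain t where "t \<in> {0..1}" "y = g t" by (auto simp: path_image_def)
    with y(2) show thesis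
      by (intro that[of t]) (auto simp: insert_commute)
  qed
  have C': "C = g ` {0..1} \<union> uminus ` g ` {0..1}" using g(5) by (simp add: path_image_def)
  have cg: "g ` closure X \<subseteq> closure (g ` X)" if "X \<subseteq> {0..1}" for X
    by (rule image_closure_subset)
       (use cont closure_subset[of "g ` X"] closure_minimal[OF that] in \<open>auto intro: continuous_on_subset\<close>)
  show thesis
  proof (cases "t \<in> {0, 1}")
    case True
    then have tx: "{x, - x} = {g 0, g 1}" unfolding t(2) by (auto simp: g1)
    show thesis
    proof (rule that)
      have "continuous_on {0<..<1} g" by (rule continuous_on_subset[OF cont]) auto
      then show "connected (g ` {0<..<1})" by (rule connected_continuous_image) simp
      show "g ` {0<..<1} \<noteq> {}" by simp
      show "g ` {0<..<1} \<inter> {x, - x} = {}"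
        unfolding tx using inj[of _ 0] inj[of _ 1] by fastforce
      have "{0..1} = insert 0 (insert 1 {0<..<1::real})" by auto
      then have "g ` {0..1} = {g 0, g 1} \<union> g ` {0<..<1}" by auto
      then show "C = {x, - x} \<union> g ` {0<..<1} \<union> uminus ` g ` {0<..<1}"
        unfolding C' tx using g1 by auto
      have "closure {0<..<1::real} = {0..1}" by simp
      then have "g ` {0..1} \<subseteq> closure (g ` {0<..<1})"
        using cg[of "{0<..<1}"] by (metis closure_subset)
      then show "{x, - x} \<subseteq> closure (g ` {0<..<1})"
        unfolding tx by auto
    qed
  next
    case False
    then have t01: "0 < t" "t < 1" using t(1) by auto
    define H where "H = g ` {t<..1} \<union> uminus ` g ` {0..<t}"
    show thesis
    proof (rule that)
      show "connected H"
        unfolding H_def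
      proof (rule connected_Un)
        show "connected (g ` {t<..1})"
          by (rule connected_continuous_image[OF continuous_on_subset[OF cont]]) (use t01 in auto)
        show "connected (uminus ` g ` {0..<t})"
          by (intro connected_continuous_image[OF continuous_on_minus[OF continuous_on_id]]
                connected_continuous_image[OF continuous_on_subset[OF cont]]) (use t01 in auto)
        have "g 1 \<in> g ` {t<..1} \<inter> uminus ` g ` {0..<t}"
        proof
          show "g 1 \<in> g ` {t<..1}" using t01 by simp
          show "g 1 \<in> uminus ` g ` {0..<t}" unfolding g1 using t01 by simp
        qed
        then show "g ` {t<..1} \<inter> uminus ` g ` {0..<t} \<noteq> {}" by blast
      qed
      show "H \<noteq> {}" using t01 by (auto simp: H_def)
      have "g u \<notin> {g t, - g t}" if "u \<in> {0..1}" "u \<noteq> t" for u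
        using inj[of u t] opp[of u t] that t01 by auto
      then have "g u \<notin> {g t, - g t} \<and> - g u \<notin> {g t, - g t}" if "u \<in> {0..1}" "u \<noteq> t" for u
      proof -
        have "g u \<noteq> g t" "g u \<noteq> - g t" using that \<open>\<And>u. u \<in> {0..1} \<Longrightarrow> u \<noteq> t \<Longrightarrow> g u \<notin> {g t, - g t}\<close> by blast+
        moreover from this have "- g u \<noteq> g t" "- g u \<noteq> - g t" by (metis minus_minus)+
        ultimately show ?thesis by blast
      qed
      note nn = this
      show "H \<inter> {x, - x} = {}"
      proof (rule equals0I)
        fix y assume y: "y \<in> H \<inter> {x, - x}"
        then consider u where "u \<in> {t<..1}" "y = g u" | u where "u \<in> {0..<t}" "y = - g u"
          unfolding H_def by blast
        then have "\<exists>u. u \<in> {0..1} \<and> u \<noteq> t \<and> (y = g u \<or> y = - g u)"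
        proof cases
          case (1 u)
          with t01 show ?thesis by (intro exI[of _ u]) simp
        next
          case (2 u)
          with t01 show ?thesis by (intro exI[of _ u]) simp
        qed
        then obtain u where "u \<in> {0..1}" "u \<noteq> t" "y = g u \<or> y = - g u" by blast
        moreover have "y \<in> {g t, - g t}" using y t(2) by blast
        ultimately show False using nn[of u] by metis
      qed
      have "{0..1} = {0..<t} \<union> {t} \<union> {t<..1}" using t01 by auto
      then have "g ` {0..1} = g ` {0..<t} \<union> {g t} \<union> g ` {t<..1}" by auto
      then show "C = {x, - x} \<union> H \<union> uminus ` H"
        unfolding C' t(2) H_def by (auto simp: image_Un image_image)
      have "{t<..1} \<subseteq> {0..1}" "{0..<t} \<subseteq> {0..1}" using t01 by auto
      from this[THEN cg] have gt: "g t \<in> closure (g ` {t<..1})" "g t \<in> closure (g ` {0..<t})"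
        using t01 by auto
      have "uminus ` closure (g ` {0..<t}) \<subseteq> closure (uminus ` g ` {0..<t})"
        by (rule image_closure_subset) (auto intro!: continuous_intros simp: closure_subset[THEN subsetD])
      with gt(2) have "- g t \<in> closure (uminus ` g ` {0..<t})" by blast
      with gt(1)
      show "{x, - x} \<subseteq> closure H"
        unfolding t(2) H_def closure_Un by simp
    qed
  qed
qed

text \<open>The two open halves into which \<open>D\<close> cuts \<open>C\<close> lie on different sides of \<open>D\<close> because the antipodal
  map exchanges both the halves and the sides; so what remains of \<open>C\<close> is a single closed half.\<close>

lemma connected_curve_minus_side:
  assumes C: "antipodal_curve C" and D: "antipodal_curve D" and x: "C \<inter> D = {x, - x}"
    and a: "a \<in> S2" "a \<notin> D"
  shows "connected (C \<inter> (S2 - side D a))"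
proof -
  obtain H where H: "connected H" "H \<noteq> {}" "C = {x, - x} \<union> H \<union> uminus ` H" "H \<inter> {x, - x} = {}"
    "{x, - x} \<subseteq> closure H"
    using antipodal_curve_halves[OF C, of x] x by blast
  have CS: "C \<subseteq> S2" and HC: "H \<subseteq> C" and HD: "H \<inter> D = {}"
    using antipodal_curve_subset[OF C] H x by auto
  have xD: "x \<in> D" "- x \<in> D" using x by auto
  obtain b where b: "b \<in> H" using H by blast
  have bS: "b \<in> S2" "b \<notin> D" using b CS HC HD by auto
  have Hb: "H \<subseteq> side D b"
    using H(1) b CS HC HD by (intro side_maximal) auto
  have Hb': "uminus ` H \<subseteq> side D (- b)"
    using Hb side_uminus[of D b] antipodal_curve_uminus[OF D] bS by blast
  have disj: "side D b \<inter> side D (- b) = {}"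
    using sides_of_antipodal_curve(2)[OF D bS] .
  have sub: "side D y \<inter> D = {}" for y using side_subset by blast
  have conn: "connected ({x, - x} \<union> H)"
    by (rule connected_intermediate_closure[OF H(1)]) (use H(5) closure_subset in auto)
  consider "side D a = side D b" | "side D a = side D (- b)"
    using side_cases[OF D bS a] by blast
  then show ?thesis
  proof cases
    case 1
    have "C \<inter> (S2 - side D a) = {x, - x} \<union> uminus ` H"
      unfolding 1 using Hb Hb' disj xD sub[of b] CS H(3) by blast
    moreover have "{x, - x} \<union> uminus ` H = uminus ` ({x, - x} \<union> H)" by auto
    ultimately show ?thesis
      using conn by (simp only:) (intro connected_continuous_image continuous_intros)
  next
    case 2
    have "C \<inter> (S2 - side D a) = {x, - x} \<union> H"
      unfolding 2 using Hb Hb' disj xD sub[of "- b"] CS H(3) by blast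
    then show ?thesis using conn by simp
  qed
qed

section \<open>Arrangements of antipodal curves\<close>

locale antipodal_arrangement =
  fixes \<A> :: "(real^3) set set"
  assumes fin: "finite \<A>"
    and curve: "C \<in> \<A> \<Longrightarrow> antipodal_curve C"
    and meet: "C \<in> \<A> \<Longrightarrow> D \<in> \<A> \<Longrightarrow> C \<noteq> D \<Longrightarrow> \<exists>x. C \<inter> D = {x, - x}"
begin

definition region :: "(real^3) set set \<Rightarrow> real^3 \<Rightarrow> (real^3) set" where
  "region \<B> a = S2 \<inter> (\<Inter>C\<in>\<B>. side C a)"

definition generic :: "(real^3) set" where
  "generic = S2 - \<Union>\<A>"

lemma genericD: "a \<in> generic \<Longrightarrow> a \<in> S2" "a \<in> generic \<Longrightarrow> C \<in> \<A> \<Longrightarrow> a \<notin> C"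
  by (auto simp: generic_def)

lemma region_refl: "\<B> \<subseteq> \<A> \<Longrightarrow> a \<in> S2 \<Longrightarrow> a \<notin> \<Union>\<B> \<Longrightarrow> a \<in> region \<B> a"
  by (auto simp: region_def intro: side_refl)

lemma openin_region: "\<B> \<subseteq> \<A> \<Longrightarrow> openin (top_of_set S2) (region \<B> a)"
proof -
  assume B: "\<B> \<subseteq> \<A>"
  then have "finite \<B>" using fin finite_subset by blast
  moreover have "openin (top_of_set S2) (side C a)" if "C \<in> \<B>" for C
    using that B curve openin_side antipodal_curve_closed by blast
  ultimately have "openin (top_of_set S2) (S2 \<inter> \<Inter>((\<lambda>C. side C a) ` \<B>))"
  proof (induction \<B>)
    case (insert C \<B>)
    then have "openin (top_of_set S2) (side C a \<inter> (S2 \<inter> \<Inter>((\<lambda>C. side C a) ` \<B>)))"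
      by (intro openin_Int insert.IH insert.prems) (use insert.prems in auto)
    then show ?case by (simp add: Int_left_commute)
  qed simp
  then show ?thesis by (simp add: region_def)
qed

text \<open>The induction step applies Janiszewski's theorem to \<open>C\<close> and to the complement \<open>T\<close> of the region
  of the previous curves, with \<open>- a\<close> as the centre of projection: it belongs to \<open>T\<close> as soon as there is a previous
  curve, and it is separated from \<open>a\<close> by \<open>C\<close>.\<close>

lemma connected_region:
  assumes "\<B> \<subseteq> \<A>" "a \<in> S2" "a \<notin> \<Union>\<B>"
  shows "connected (region \<B> a)"
proof -
  have "finite \<B>" using assms fin finite_subset by blast
  then show ?thesis using assms
  proof (induction \<B>)
    case empty
    then show ?case by (simp add: region_def connected_S2)
  next
    case (insert C \<B>)
    have C: "antipodal_curve C" and aC: "a \<notin> C" and a: "a \<in> S2"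
      using insert.prems curve by auto
    have B: "antipodal_curve D \<and> a \<notin> D" if "D \<in> \<B>" for D
      using that insert.prems curve by auto
    have IH: "connected (region \<B> a)" using insert by auto
    define R where "R = region (insert C \<B>) a"
    have aR: "a \<in> R" unfolding R_def using insert.prems by (intro region_refl) auto
    have Req: "R = region \<B> a \<inter> side C a" by (auto simp: R_def region_def)
    have "connected_component R a b" if b: "b \<in> R" for b
    proof (cases "\<B> = {}")
      case True
      have "R = side C a" unfolding Req using True side_subset[of C a] by (auto simp: region_def)
      then show ?thesis
        unfolding connected_component_def using aR b connected_side by blast
    next
      case False
      then obtain D0 where D0: "D0 \<in> \<B>" by blast
      define T where "T = S2 - region \<B> a"
      have Teq: "T = (\<Union>D\<in>\<B>. S2 - side D a)" unfolding T_def region_def using False by blast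
      have half: "connected (C \<inter> (S2 - side D a))" if D: "D \<in> \<B>" for D
      proof -
        have "C \<noteq> D" using insert.hyps D by blast
        then obtain x where "C \<inter> D = {x, - x}" using meet[of C D] insert.prems(1) D by blast
        then show ?thesis using connected_curve_minus_side C B[OF D] a by blast
      qed
      \<comment> \<open>Two closed half-curves of \<open>C\<close> intersect: one of them contains a pair of antipodal points and
        the other one contains at least one point of each such pair.\<close>
      have touch: "\<exists>y. y \<in> C \<and> y \<in> S2 - side D a \<and> y \<in> S2 - side D0 a" if D: "D \<in> \<B>" for D
      proof -
        have "C \<noteq> D" using insert.hyps D by blast
        then obtain x where x: "C \<inter> D = {x, - x}" using meet[of C D] insert.prems(1) D by blast
        have xS: "x \<in> S2" using x antipodal_curve_subset[OF C] by blast
        have nx: "y \<notin> side D a" if "y \<in> {x, - x}" for y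
          using that x side_subset[of D a] by blast
        have "x \<notin> side D0 a \<or> - x \<notin> side D0 a"
        proof (rule ccontr)
          assume "\<not> ?thesis"
          then have 1: "x \<in> side D0 a" "- x \<in> side D0 a" by auto
          have "x \<in> S2" "x \<notin> D0" using 1(1) side_subset[of D0 a] by auto
          then have "- x \<notin> side D0 x" using antipode_not_in_side B[OF D0] by blast
          then show False using 1 side_eq[of x D0 a] by simp
        qed
        then show ?thesis using nx x xS by (metis DiffI Int_iff insertCI minus_mem_S2)
      qed
      have "connected (C \<inter> T)"
      proof -
        define U where "U D = C \<inter> (S2 - side D a) \<union> C \<inter> (S2 - side D0 a)" for D
        have "connected (U D)" if "D \<in> \<B>" for D
          unfolding U_def by (rule connected_Un[OF half[OF that] half[OF D0]]) (use touch[OF that] in blast)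
        moreover have "(\<Inter>D\<in>\<B>. U D) \<noteq> {}"
          using touch[OF D0] unfolding U_def by blast
        ultimately have "connected (\<Union>D\<in>\<B>. U D)"
          by (intro connected_Union) auto
        moreover have "(\<Union>D\<in>\<B>. U D) = C \<inter> T" unfolding U_def Teq using D0 by blast
        ultimately show ?thesis by simp
      qed
      moreover have "closed T"
      proof -
        have "openin (top_of_set S2) (region \<B> a)" using insert.prems by (intro openin_region) auto
        then have "closedin (top_of_set S2) T" unfolding T_def by (simp add: closedin_diff)
        then show ?thesis using closed_S2 closedin_closed_trans by blast
      qed
      moreover have "- a \<in> T" "- a \<notin> side C a" "- a \<notin> C"
        unfolding Teq using D0 B[OF D0] a antipode_not_in_side[of D0 a] antipode_not_in_side[OF C a aC]
          antipodal_curve_uminus[OF C] aC by auto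
      moreover have "a \<in> side C a" "a \<in> region \<B> a" "b \<in> side C a" "b \<in> region \<B> a"
        using aR b Req by auto
      moreover have "region \<B> a \<subseteq> S2 - T" unfolding T_def by (auto simp: region_def)
      moreover have "T \<subseteq> S2" by (auto simp: T_def)
      ultimately obtain X where X: "connected X" "X \<subseteq> S2 - C - T" "a \<in> X" "b \<in> X"
        using sphere_Janiszewski[OF antipodal_curve_compact[OF C] antipodal_curve_subset[OF C],
            of T "- a" "side C a" a b "region \<B> a"] connected_side side_subset IH by metis
      have "X \<subseteq> side C a" using X by (intro side_maximal) auto
      moreover have "X \<subseteq> region \<B> a" using X(2) by (auto simp: T_def)
      ultimately have "X \<subseteq> R" using Req by blast
      then show ?thesis unfolding connected_component_def using X by blast
    qed
    then show ?case
      unfolding R_def[symmetric] connected_iff_connected_component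
      using connected_component_sym connected_component_trans by metis
  qed
qed

lemma component_eq_region:
  assumes a: "a \<in> generic"
  shows "connected_component_set (S2 - \<Union>\<A>) a = region \<A> a"
proof
  let ?Y = "connected_component_set (S2 - \<Union>\<A>) a"
  have Y: "?Y \<subseteq> S2 - \<Union>\<A>" by (rule connected_component_subset)
  have aY: "a \<in> ?Y" using a by (simp add: generic_def)
  have "?Y \<subseteq> side C a" if "C \<in> \<A>" for C
    using Y aY that by (intro side_maximal) auto
  then show "?Y \<subseteq> region \<A> a" using Y by (auto simp: region_def)
  have "region \<A> a \<subseteq> S2 - \<Union>\<A>"
    using side_subset unfolding region_def by blast
  moreover have "connected (region \<A> a)" "a \<in> region \<A> a"
    using connected_region[of \<A> a] region_refl[of \<A> a] genericD[OF a] by auto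
  ultimately show "region \<A> a \<subseteq> ?Y"
    by (intro connected_component_maximal)
qed

lemma cells_eq: "cells S2 \<A> = region \<A> ` generic"
  unfolding cells_def components_def using component_eq_region
  by (simp add: generic_def[symmetric])

definition sep :: "real^3 \<Rightarrow> real^3 \<Rightarrow> (real^3) set set" where
  "sep a b = {C \<in> \<A>. side C a \<noteq> side C b}"

lemma finite_sep: "finite (sep a b)"
  using fin by (simp add: sep_def)

lemma region_subset_side: "C \<in> \<A> \<Longrightarrow> region \<A> a \<subseteq> side C a"
  by (auto simp: region_def)

lemma mem_region_iff: "b \<in> generic \<Longrightarrow> b \<in> region \<A> a \<longleftrightarrow> sep a b = {}"
proof
  assume b: "b \<in> generic" and "b \<in> region \<A> a"
  then have "side C b = side C a" if "C \<in> \<A>" for C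
    using that side_eq[of b C a] by (auto simp: region_def)
  then show "sep a b = {}" by (auto simp: sep_def)
next
  assume b: "b \<in> generic" and "sep a b = {}"
  then have "b \<in> side C a" if "C \<in> \<A>" for C
    using that side_refl[of b C] genericD[OF b] by (auto simp: sep_def)
  then show "b \<in> region \<A> a" using genericD[OF b] by (auto simp: region_def)
qed

lemma closure_region_generic:
  assumes yg: "y \<in> generic" and y: "y \<in> closure (region \<A> a)"
  shows "y \<in> region \<A> a"
proof -
  obtain O' where O: "open O'" "region \<A> y = S2 \<inter> O'"
    using openin_region[of \<A>] unfolding openin_open by blast
  have yy: "y \<in> region \<A> y" using region_refl[of \<A> y] genericD[OF yg] by blast
  then have "O' \<inter> region \<A> a \<noteq> {}"
    using O y by (metis IntD2 disjoint_iff open_Int_closure_eq_empty)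
  then obtain z where z: "z \<in> region \<A> y" "z \<in> region \<A> a" using O by (auto simp: region_def)
  have "side C y = side C a" if "C \<in> \<A>" for C
    using z region_subset_side[OF that] side_eq[of z C y] side_eq[of z C a] by (metis subsetD)
  then have "region \<A> y = region \<A> a" by (simp add: region_def)
  then show ?thesis using yy by simp
qed

lemma region_eq_iff: "a \<in> generic \<Longrightarrow> b \<in> generic \<Longrightarrow> region \<A> a = region \<A> b \<longleftrightarrow> sep a b = {}"
proof
  assume "b \<in> generic" "region \<A> a = region \<A> b"
  then show "sep a b = {}" using mem_region_iff[of b a] mem_region_iff[of b b] by (simp add: sep_def)
next
  assume "sep a b = {}"
  then have "side C a = side C b" if "C \<in> \<A>" for C using that by (auto simp: sep_def)
  then show "region \<A> a = region \<A> b" by (simp add: region_def)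
qed

lemma other_side:
  assumes "C \<in> \<A>" "a \<in> generic" "b \<in> generic" "c \<in> generic" "C \<in> sep a b" "C \<in> sep a c"
  shows "side C b = side C c"
proof -
  have "side C b = side C a \<or> side C b = side C (- a)" "side C c = side C a \<or> side C c = side C (- a)"
    by (intro side_cases[OF curve]; use assms(1-4) in \<open>simp add: genericD\<close>)+
  then show ?thesis using assms(5,6) by (auto simp: sep_def)
qed

abbreviation vertices :: "(real^3) set" where
  "vertices \<equiv> arr_vertices \<A>"

lemma finite_vertices: "finite vertices"
proof -
  have "finite (C \<inter> D)" if CD: "C \<in> \<A>" "D \<in> \<A>" "C \<noteq> D" for C D
    using meet[OF CD] by auto
  then have "finite (\<Union>C\<in>\<A>. \<Union>D\<in>\<A> - {C}. C \<inter> D)"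
    using fin by (intro finite_UN_I finite_Diff) auto
  moreover have "vertices \<subseteq> (\<Union>C\<in>\<A>. \<Union>D\<in>\<A> - {C}. C \<inter> D)"
    unfolding arr_vertices_def by blast
  ultimately show ?thesis by (rule rev_finite_subset)
qed

lemma not_vertexD: "x \<notin> vertices \<Longrightarrow> x \<in> C \<Longrightarrow> C \<in> \<A> \<Longrightarrow> D \<in> \<A> \<Longrightarrow> D \<noteq> C \<Longrightarrow> x \<notin> D"
  unfolding arr_vertices_def by blast

text \<open>Each side of \<open>C\<close> accumulates at every point of \<open>C\<close>, whereas the other curves are closed and avoid
  \<open>x\<close>, so that a neighbourhood of \<open>x\<close> lies on one side of each of them.\<close>

lemma closure_region_iff:
  assumes a: "a \<in> generic" and C: "C \<in> \<A>" and x: "x \<in> C - vertices"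
  shows "x \<in> closure (region \<A> a) \<longleftrightarrow> (\<forall>D\<in>\<A> - {C}. x \<in> side D a)"
proof
  have xS: "x \<in> S2" using antipodal_curve_subset[OF curve[OF C]] x by blast
  assume cl: "x \<in> closure (region \<A> a)"
  show "\<forall>D\<in>\<A> - {C}. x \<in> side D a"
  proof (rule ballI, rule ccontr)
    fix D assume D: "D \<in> \<A> - {C}" and no: "x \<notin> side D a"
    have cD: "antipodal_curve D" and aD: "a \<in> S2" "a \<notin> D" using D curve genericD[OF a] by auto
    have "x \<notin> D" using not_vertexD x C D by blast
    then have xa: "x \<in> side D (- a)"
      using sides_of_antipodal_curve(1)[OF cD aD] xS no by blast
    obtain O' where O: "open O'" "side D (- a) = S2 \<inter> O'"
      using openin_side[OF antipodal_curve_closed[OF cD]] unfolding openin_open by blast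
    have "O' \<inter> region \<A> a \<noteq> {}"
      using O xa cl by (metis IntD2 disjoint_iff open_Int_closure_eq_empty)
    moreover have "region \<A> a \<subseteq> S2 \<inter> side D a" using D by (auto simp: region_def)
    ultimately show False using sides_of_antipodal_curve(2)[OF cD aD] O(2) by blast
  qed
next
  assume sd: "\<forall>D\<in>\<A> - {C}. x \<in> side D a"
  have xS: "x \<in> S2" using antipodal_curve_subset[OF curve[OF C]] x by blast
  obtain O' where O: "open O'" "region (\<A> - {C}) a = S2 \<inter> O'"
    using openin_region[of "\<A> - {C}"] unfolding openin_open by blast
  have "x \<in> O'" using sd xS O(2) unfolding region_def by blast
  moreover have "x \<in> closure (side C a)"
    using sides_of_antipodal_curve(3)[OF curve[OF C], of a] genericD[OF a] C x by blast
  ultimately have "x \<in> closure (O' \<inter> side C a)"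
    using open_Int_closure_subset[OF O(1)] by blast
  moreover have "O' \<inter> side C a \<subseteq> region \<A> a"
    using O(2) side_subset[of C a] unfolding region_def by blast
  ultimately show "x \<in> closure (region \<A> a)" using closure_mono by blast
qed

text \<open>An edge is connected and avoids all curves but one, so all its points have the same position
  with respect to the other curves.\<close>

lemma edge_subset_closure_iff:
  assumes a: "a \<in> generic" and C: "C \<in> \<A>" and e: "e \<in> components (C - vertices)" and x: "x \<in> e"
  shows "e \<subseteq> closure (region \<A> a) \<longleftrightarrow> x \<in> closure (region \<A> a)"
proof
  assume "x \<in> closure (region \<A> a)"
  have sub: "e \<subseteq> C - vertices" using e in_components_subset by blast
  have con: "connected e" using e in_components_connected by blast
  have eS: "e \<subseteq> S2" using sub antipodal_curve_subset[OF curve[OF C]] by blast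
  have "y \<in> side D a" if D: "D \<in> \<A> - {C}" and y: "y \<in> e" for y D
  proof -
    have "x \<in> side D a"
      using closure_region_iff[OF a C] x sub D \<open>x \<in> closure (region \<A> a)\<close> by blast
    moreover have "e \<subseteq> side D x"
      using con x eS not_vertexD[OF _ _ C] sub D by (intro side_maximal) blast+
    ultimately show ?thesis using side_eq y by blast
  qed
  then show "e \<subseteq> closure (region \<A> a)"
    using closure_region_iff[OF a C] sub by blast
qed (use x in auto)

lemma side_at_point:
  assumes a: "a \<in> generic" and C: "C \<in> \<A>" and x: "x \<in> C - vertices" "x \<in> closure (region \<A> a)"
  obtains e where "e \<in> sides \<A> (region \<A> a)" "x \<in> e" "e \<in> components (C - vertices)"
proof -
  define e where "e = connected_component_set (C - vertices) x"
  have e: "e \<in> components (C - vertices)" "x \<in> e"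
    unfolding e_def using x(1) by (auto simp: componentsI)
  then have "e \<subseteq> closure (region \<A> a)" using edge_subset_closure_iff[OF a C] x(2) by blast
  then have "e \<in> sides \<A> (region \<A> a)"
    unfolding sides_def arr_edges_def using e C by blast
  then show thesis using that e by blast
qed

definition bordering :: "real^3 \<Rightarrow> (real^3) set set" where
  "bordering a = {C \<in> \<A>. \<exists>x \<in> C - vertices. x \<in> closure (region \<A> a)}"

lemma neighbour_across:
  assumes a: "a \<in> generic" and C: "C \<in> bordering a"
  obtains b where "b \<in> generic" "sep a b = {C}"
proof -
  have C\<A>: "C \<in> \<A>" using C by (simp add: bordering_def)
  obtain x where x: "x \<in> C - vertices" "x \<in> closure (region \<A> a)" using C by (auto simp: bordering_def)
  have aC: "a \<in> S2" "a \<notin> C" "- a \<in> S2" "- a \<notin> C"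
    using genericD[OF a] C\<A> antipodal_curve_uminus[OF curve[OF C\<A>]] by auto
  have xS: "x \<in> S2" using antipodal_curve_subset[OF curve[OF C\<A>]] x by blast
  obtain O' where O: "open O'" "region (\<A> - {C}) a = S2 \<inter> O'"
    using openin_region[of "\<A> - {C}"] unfolding openin_open by blast
  have "x \<in> region (\<A> - {C}) a"
    using closure_region_iff[OF a C\<A> x(1)] x(2) xS unfolding region_def by blast
  then have "x \<in> O'" using O by blast
  moreover have "x \<in> closure (side C (- a))"
    using sides_of_antipodal_curve(3)[OF curve[OF C\<A>] aC(3,4)] x by blast
  ultimately have "O' \<inter> side C (- a) \<noteq> {}"
    using O(1) by (metis disjoint_iff open_Int_closure_eq_empty)
  then obtain b where b: "b \<in> O'" "b \<in> side C (- a)" by blast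
  then have bS: "b \<in> S2" "b \<notin> C" using side_subset[of C] by auto
  then have bR: "b \<in> side D a" if "D \<in> \<A> - {C}" for D using O(2) b that unfolding region_def by blast
  have "b \<in> generic"
    unfolding generic_def using bS bR side_subset by blast
  moreover have "side C a \<noteq> side C b"
    using b(2) side_eq[of b C "- a"] sides_of_antipodal_curve(2)[OF curve[OF C\<A>] aC(1,2)] side_refl[OF aC(1,2)] by blast
  moreover have "side D a = side D b" if "D \<in> \<A> - {C}" for D
    using bR[OF that] side_eq by blast
  ultimately show thesis using that[of b] C\<A> unfolding sep_def by blast
qed

lemma bordering_transfer:
  assumes a: "a \<in> generic" and b: "b \<in> generic" and s: "sep a b \<subseteq> {C}" and C: "C \<in> \<A>"
    and x: "x \<in> C - vertices" "x \<in> closure (region \<A> a)"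
  shows "x \<in> closure (region \<A> b)"
proof -
  have "side D a = side D b" if "D \<in> \<A> - {C}" for D using s that unfolding sep_def by blast
  then show ?thesis
    using closure_region_iff[OF a C x(1)] closure_region_iff[OF b C x(1)] x(2) by simp
qed

lemma share_side_iff:
  assumes a: "a \<in> generic" and b: "b \<in> generic" and ne: "region \<A> a \<noteq> region \<A> b"
  shows "sides \<A> (region \<A> a) \<inter> sides \<A> (region \<A> b) \<noteq> {} \<longleftrightarrow> (\<exists>C \<in> bordering a. sep a b = {C})"
proof
  assume "sides \<A> (region \<A> a) \<inter> sides \<A> (region \<A> b) \<noteq> {}"
  then obtain e where e: "e \<in> arr_edges \<A>" "e \<subseteq> closure (region \<A> a)" "e \<subseteq> closure (region \<A> b)"
    unfolding sides_def by blast
  then obtain C where C: "C \<in> \<A>" "e \<in> components (C - vertices)" unfolding arr_edges_def by blast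
  obtain x where x: "x \<in> e" using in_components_nonempty[OF C(2)] by blast
  have xC: "x \<in> C - vertices" using x in_components_subset[OF C(2)] by blast
  have x2: "x \<in> closure (region \<A> a)" "x \<in> closure (region \<A> b)" using x e by auto
  have "side D a = side D b" if D: "D \<in> \<A> - {C}" for D
  proof -
    have "x \<in> side D a" "x \<in> side D b"
      using D x2 closure_region_iff[OF a C(1) xC] closure_region_iff[OF b C(1) xC] by auto
    then show ?thesis using side_eq by metis
  qed
  then have "sep a b \<subseteq> {C}" unfolding sep_def by blast
  moreover have "sep a b \<noteq> {}" using region_eq_iff[OF a b] ne by blast
  ultimately have "sep a b = {C}" by blast
  moreover have "C \<in> bordering a" using C(1) xC x2 by (auto simp: bordering_def)
  ultimately show "\<exists>C \<in> bordering a. sep a b = {C}" by blast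
next
  assume "\<exists>C \<in> bordering a. sep a b = {C}"
  then obtain C x where C: "C \<in> \<A>" "sep a b = {C}" and x: "x \<in> C - vertices" "x \<in> closure (region \<A> a)"
    unfolding bordering_def by blast
  have "x \<in> closure (region \<A> b)"
    using bordering_transfer[OF a b _ C(1) x] C(2) by blast
  then have "\<exists>e. x \<in> e \<and> e \<in> components (C - vertices) \<and> e \<in> sides \<A> (region \<A> a)"
    using side_at_point[OF a C(1) x] by blast
  then obtain e where e: "x \<in> e" "e \<in> components (C - vertices)" "e \<in> sides \<A> (region \<A> a)" by blast
  then have "e \<subseteq> closure (region \<A> b)"
    using edge_subset_closure_iff[OF b C(1) e(2,1)] \<open>x \<in> closure (region \<A> b)\<close> by blast
  then have "e \<in> sides \<A> (region \<A> b)" using e(3) unfolding sides_def by blast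
  then show "sides \<A> (region \<A> a) \<inter> sides \<A> (region \<A> b) \<noteq> {}" using e(3) by blast
qed

abbreviation graph :: "(real^3) set ugraph" where
  "graph \<equiv> dual_graph S2 \<A>"

lemma edge_iff:
  assumes a: "a \<in> generic" and b: "b \<in> generic"
  shows "{region \<A> a, region \<A> b} \<in> snd graph \<longleftrightarrow> (\<exists>C \<in> bordering a. sep a b = {C})"
proof -
  have "{region \<A> a, region \<A> b} \<in> snd graph \<longleftrightarrow>
      region \<A> a \<noteq> region \<A> b \<and> sides \<A> (region \<A> a) \<inter> sides \<A> (region \<A> b) \<noteq> {}"
    using a b unfolding dual_graph_def cells_eq by (auto simp: doubleton_eq_iff)
  also have "\<dots> \<longleftrightarrow> (\<exists>C \<in> bordering a. sep a b = {C})"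
    using share_side_iff[OF a b] region_eq_iff[OF a b] by (metis insert_not_empty)
  finally show ?thesis .
qed

text \<open>The witness is found on the boundary of the region of \<open>a\<close> inside the larger region \<open>W\<close> of
  the curves that do not separate \<open>a\<close> from \<open>b\<close>. Since \<open>W\<close> stays connected when the vertices are
  removed, it has a boundary point \<open>y\<close> on a single curve, and this curve, meeting \<open>W\<close>, must be a
  separating one.\<close>

lemma sep_step:
  assumes a: "a \<in> generic" and b: "b \<in> generic" and ne: "sep a b \<noteq> {}"
  obtains C where "C \<in> bordering a" "C \<in> sep a b"
proof -
  define W where "W = region (\<A> - sep a b) a"
  have aW: "a \<in> W" unfolding W_def using genericD[OF a] by (intro region_refl) auto
  have bW: "b \<in> W"
    unfolding W_def region_def using side_refl genericD[OF b] by (auto simp: sep_def)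
  have "connected W" "openin (top_of_set S2) W"
    unfolding W_def using genericD[OF a] by (auto intro!: connected_region openin_region)
  then have conn: "connected (W - vertices)"
    using connected_openin_sphere_diff_finite finite_vertices by blast
  have Wc: "region \<A> a \<subseteq> W" by (auto simp: W_def region_def)
  have gv: "generic \<inter> vertices = {}" by (auto simp: generic_def arr_vertices_def)
  have rv: "region \<A> a \<inter> vertices = {}"
    using side_subset unfolding arr_vertices_def region_def by blast
  have "\<exists>y \<in> W - vertices. y \<in> closure (region \<A> a) \<and> y \<notin> region \<A> a"
  proof (rule ccontr)
    assume "\<not> ?thesis"
    then have eq: "region \<A> a = (W - vertices) \<inter> closure (region \<A> a)"
      using closure_subset[of "region \<A> a"] Wc rv by blast
    have "closedin (top_of_set (W - vertices)) (region \<A> a)"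
      by (subst eq) (rule closedin_closed_Int[OF closed_closure])
    moreover have "openin (top_of_set (W - vertices)) (region \<A> a)"
    proof (rule openin_subset_trans[of S2])
      show "openin (top_of_set S2) (region \<A> a)" by (rule openin_region) simp
      show "region \<A> a \<subseteq> W - vertices" using Wc rv by blast
      show "W - vertices \<subseteq> S2" by (auto simp: W_def region_def)
    qed
    ultimately have "region \<A> a = {} \<or> region \<A> a = W - vertices"
      using conn[unfolded connected_clopen, rule_format, OF conjI] by blast
    moreover have "a \<in> region \<A> a" using region_refl[of \<A> a] genericD[OF a] by blast
    ultimately have "b \<in> region \<A> a" using bW b gv by blast
    then show False using mem_region_iff[OF b] ne by blast
  qed
  then obtain y where y: "y \<in> W" "y \<notin> vertices" "y \<in> closure (region \<A> a)" "y \<notin> region \<A> a" by blast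
  have yS: "y \<in> S2" using y(1) by (auto simp: W_def region_def)
  have "\<exists>C\<in>\<A>. y \<in> C"
    using closure_region_generic[of y a] y(3,4) yS unfolding generic_def by blast
  then obtain C where C: "C \<in> \<A>" "y \<in> C" by blast
  have "C \<in> sep a b"
  proof (rule ccontr)
    assume "C \<notin> sep a b"
    then have "y \<in> side C a" using y(1) C(1) unfolding W_def region_def by blast
    then show False using C(2) side_subset[of C a] by blast
  qed
  moreover have "C \<in> bordering a" using C y by (auto simp: bordering_def)
  ultimately show thesis using that by blast
qed

lemma sep_other:
  assumes g: "a \<in> generic" "b \<in> generic" "c \<in> generic" and C: "sep a c = {C}" "C \<in> sep a b"
  shows "sep c b = sep a b - {C}"
proof -
  have "side C b = side C c"
    using other_side[OF _ g C(2)] C unfolding sep_def by blast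
  moreover have "side D a = side D c" if "D \<in> \<A>" "D \<noteq> C" for D
    using C(1) that unfolding sep_def by blast
  ultimately show ?thesis unfolding sep_def by auto
qed

abbreviation adj :: "((real^3) set \<times> (real^3) set) set" where
  "adj \<equiv> {(x, y). {x, y} \<in> snd graph}"

lemma walk_length_ge:
  "a \<in> generic \<Longrightarrow> b \<in> generic \<Longrightarrow> (region \<A> a, region \<A> b) \<in> adj ^^ n \<Longrightarrow> card (sep a b) \<le> n"
proof (induction n arbitrary: b)
  case 0
  then show ?case using region_eq_iff by simp
next
  case (Suc n)
  then obtain y where y: "(region \<A> a, y) \<in> adj ^^ n" "(y, region \<A> b) \<in> adj" by auto
  then have "y \<in> region \<A> ` generic"
    unfolding dual_graph_def cells_eq by (auto simp: doubleton_eq_iff)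
  then obtain c where c: "c \<in> generic" "y = region \<A> c" by blast
  then obtain C where C: "sep c b = {C}" using y(2) edge_iff[OF c(1) Suc.prems(2)] by auto
  have "sep a b \<subseteq> insert C (sep a c)" using C unfolding sep_def by blast
  then have "card (sep a b) \<le> card (insert C (sep a c))"
    using finite_sep by (intro card_mono) auto
  also have "\<dots> \<le> Suc (card (sep a c))" by (rule card_insert_le_m1) simp_all
  also have "\<dots> \<le> Suc n" using Suc.IH[OF Suc.prems(1) c(1)] y(1) c(2) by simp
  finally show ?case .
qed

lemma walk_of_sep:
  "a \<in> generic \<Longrightarrow> b \<in> generic \<Longrightarrow> (region \<A> a, region \<A> b) \<in> adj ^^ card (sep a b)"
proof (induction "card (sep a b)" arbitrary: a)
  case 0
  then have "region \<A> a = region \<A> b" using region_eq_iff finite_sep by simp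
  then show ?case using 0 by simp
next
  case (Suc n)
  then have "sep a b \<noteq> {}" by auto
  then obtain C where C: "C \<in> bordering a" "C \<in> sep a b" using sep_step Suc.prems by blast
  then obtain c where c: "c \<in> generic" "sep a c = {C}" using neighbour_across Suc.prems(1) by blast
  have s: "sep c b = sep a b - {C}" using sep_other Suc.prems c C by blast
  then have "n = card (sep c b)" using Suc.hyps(2) C(2) by (simp add: card_Diff_singleton)
  then have "(region \<A> c, region \<A> b) \<in> adj ^^ n" using Suc.hyps(1)[of c] c(1) Suc.prems(2) by simp
  moreover have "(region \<A> a, region \<A> c) \<in> adj" using edge_iff[OF Suc.prems(1) c(1)] C(1) c(2) by auto
  ultimately have "(region \<A> a, region \<A> b) \<in> adj ^^ Suc n" by (rule relpow_Suc_I2[rotated])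
  then show ?case by (simp only: Suc.hyps(2))
qed

lemma graph_dist_eq_card_sep:
  assumes "a \<in> generic" "b \<in> generic"
  shows "graph_dist graph (region \<A> a) (region \<A> b) = enat (card (sep a b))"
  unfolding graph_dist_def
proof (rule antisym)
  show "(INF n \<in> {n. (region \<A> a, region \<A> b) \<in> adj ^^ n}. enat n) \<le> enat (card (sep a b))"
    using walk_of_sep[OF assms] by (intro INF_lower) simp
  show "enat (card (sep a b)) \<le> (INF n \<in> {n. (region \<A> a, region \<A> b) \<in> adj ^^ n}. enat n)"
    using walk_length_ge[OF assms] by (intro INF_greatest) simp
qed

theorem partial_cube_graph: "partial_cube graph"
proof -
  have "simple_graph graph" unfolding simple_graph_def dual_graph_def by auto
  moreover obtain ps where ps: "set ps = \<A>" "distinct ps" using finite_distinct_list[OF fin] by blast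
  \<comment> \<open>The labels record on which curves a cell is on the same side as the reference point \<open>o'\<close>.\<close>
  define o' where "o' = (SOME a. a \<in> generic)"
  define l where "l c = map (\<lambda>C. c \<subseteq> side C o') ps" for c
  have "graph_dist graph u v = enat (hamming_dist (l u) (l v))" if uv: "u \<in> fst graph" "v \<in> fst graph" for u v
  proof -
    obtain a b where ab: "a \<in> generic" "b \<in> generic" and u: "u = region \<A> a" and v: "v = region \<A> b"
      using uv unfolding dual_graph_def cells_eq by auto
    have o: "o' \<in> generic" unfolding o'_def using ab(1) by (rule someI)
    have inc: "region \<A> c \<subseteq> side C o' \<longleftrightarrow> side C c = side C o'" if "c \<in> generic" "C \<in> \<A>" for c C
      using that region_refl[of \<A> c] genericD[OF that(1)] side_eq[of c C o'] region_subset_side[of C c] by blast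
    have dif: "(region \<A> a \<subseteq> side C o') \<noteq> (region \<A> b \<subseteq> side C o') \<longleftrightarrow> C \<in> sep a b" if C: "C \<in> \<A>" for C
      unfolding inc[OF ab(1) C] inc[OF ab(2) C]
      using other_side[OF C o ab] C unfolding sep_def by blast
    have "{i. i < length (l u) \<and> l u ! i \<noteq> l v ! i} = {i. i < length ps \<and> ps ! i \<in> sep a b}"
    proof (rule Collect_cong, rule conj_cong)
      show "i < length (l u) \<longleftrightarrow> i < length ps" for i by (simp add: l_def)
      fix i assume i: "i < length ps"
      then have "ps ! i \<in> \<A>" using ps(1) nth_mem by blast
      from dif[OF this] show "l u ! i \<noteq> l v ! i \<longleftrightarrow> ps ! i \<in> sep a b"
        using i by (simp only: l_def u v nth_map)
    qed
    moreover have "bij_betw ((!) ps) {i. i < length ps \<and> ps ! i \<in> sep a b} (sep a b)"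
      unfolding bij_betw_def
    proof
      show "inj_on ((!) ps) {i. i < length ps \<and> ps ! i \<in> sep a b}"
        using ps(2) by (simp add: inj_on_def nth_eq_iff_index_eq)
      have "sep a b \<subseteq> set ps" using ps(1) by (auto simp: sep_def)
      then show "(!) ps ` {i. i < length ps \<and> ps ! i \<in> sep a b} = sep a b"
        by (auto simp: in_set_conv_nth image_iff subset_iff)
    qed
    ultimately have "hamming_dist (l u) (l v) = card (sep a b)"
      unfolding hamming_dist_def using bij_betw_same_card by metis
    then show ?thesis unfolding u v using graph_dist_eq_card_sep[OF ab] by simp
  qed
  then have "(\<forall>v \<in> fst graph. length (l v) = length ps) \<and>
      (\<forall>u \<in> fst graph. \<forall>v \<in> fst graph. graph_dist graph u v = enat (hamming_dist (l u) (l v)))"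
    by (intro conjI ballI) (simp add: l_def)
  then have "\<exists>n l. (\<forall>v \<in> fst graph. length (l v) = n) \<and>
      (\<forall>u \<in> fst graph. \<forall>v \<in> fst graph. graph_dist graph u v = enat (hamming_dist (l u) (l v)))"
    by (rule_tac exI, rule_tac exI)
  ultimately show ?thesis unfolding partial_cube_def by (rule conjI)
qed

text \<open>The edges at a cell correspond to the curves that border it, as there is exactly one cell
  \<open>region \<A> (nb C)\<close> that is separated from it by \<open>C\<close> alone.\<close>

lemma card_incident_edges:
  assumes a: "a \<in> generic"
  shows "card {e \<in> snd graph. region \<A> a \<in> e} = card (bordering a)"
proof -
  define nb where "nb C = (SOME b. b \<in> generic \<and> sep a b = {C})" for C
  have nb: "nb C \<in> generic" "sep a (nb C) = {C}" if "C \<in> bordering a" for C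
  proof -
    obtain b where "b \<in> generic" "sep a b = {C}"
      by (rule neighbour_across[OF a \<open>C \<in> bordering a\<close>])
    then have "b \<in> generic \<and> sep a b = {C}" ..
    then have "nb C \<in> generic \<and> sep a (nb C) = {C}" unfolding nb_def by (rule someI)
    then show "nb C \<in> generic" "sep a (nb C) = {C}" by auto
  qed
  define f where "f C = {region \<A> a, region \<A> (nb C)}" for C
  have "inj_on f (bordering a)"
  proof (rule inj_onI)
    fix C D assume CD: "C \<in> bordering a" "D \<in> bordering a" "f C = f D"
    then have "region \<A> (nb C) = region \<A> (nb D)" unfolding f_def doubleton_eq_iff by blast
    then have "sep (nb C) (nb D) = {}" using region_eq_iff nb CD by blast
    then have "sep a (nb C) = sep a (nb D)" unfolding sep_def by auto
    then show "C = D" using nb CD by auto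
  qed
  moreover have "f ` bordering a = {e \<in> snd graph. region \<A> a \<in> e}"
  proof
    show "f ` bordering a \<subseteq> {e \<in> snd graph. region \<A> a \<in> e}"
    proof
      fix e assume "e \<in> f ` bordering a"
      then obtain C where C: "C \<in> bordering a" "e = f C" by blast
      then have "e \<in> snd graph" unfolding f_def edge_iff[OF a nb(1)[OF C(1)]] using nb(2)
        by (simp add: f_def edge_iff[OF a nb(1)[OF C(1)]])
      then show "e \<in> {e \<in> snd graph. region \<A> a \<in> e}" using C(2) by (simp add: f_def)
    qed
    show "{e \<in> snd graph. region \<A> a \<in> e} \<subseteq> f ` bordering a"
    proof
      fix e assume e: "e \<in> {e \<in> snd graph. region \<A> a \<in> e}"
      then obtain c d where "e = {c, d}" "c \<in> region \<A> ` generic" "d \<in> region \<A> ` generic"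
        unfolding dual_graph_def cells_eq by auto
      then obtain b where b: "b \<in> generic" "e = {region \<A> a, region \<A> b}" using e by auto
      then obtain C where C: "C \<in> bordering a" "sep a b = {C}" using edge_iff[OF a b(1)] e by auto
      have "sep (nb C) b = {}" using sep_other[OF a b(1) nb(1)[OF C(1)] nb(2)[OF C(1)]] C(2) by simp
      then have "region \<A> (nb C) = region \<A> b" using region_eq_iff nb(1)[OF C(1)] b(1) by blast
      then have "e = f C" using b(2) by (simp add: f_def)
      then show "e \<in> f ` bordering a" using C(1) by blast
    qed
  qed
  ultimately show ?thesis using card_image by metis
qed

end

section \<open>The covering of the projective plane by the sphere\<close>

abbreviation proj :: "real^3 \<Rightarrow> proj_plane" where "proj \<equiv> abs_proj_plane"

lemma proj_eq_iff:
  assumes "x \<in> S2" "y \<in> S2"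
  shows "proj x = proj y \<longleftrightarrow> y = x \<or> y = - x"
  using Quotient3_rel[OF Quotient3_proj_plane, of x y] assms by (auto simp: mem_S2)

lemma proj_surj: obtains x where "x \<in> S2" "proj x = p"
  using Quotient3_abs_rep[OF Quotient3_proj_plane, of p] Quotient3_rep_reflp[OF Quotient3_proj_plane, of p]
  by (auto simp: mem_S2)

lemma proj_uminus: "x \<in> S2 \<Longrightarrow> proj (- x) = proj x"
  using proj_eq_iff[of x "- x"] by simp

lemma mem_lift_set: "x \<in> lift_set U \<longleftrightarrow> x \<in> S2 \<and> proj x \<in> U"
  by (simp add: lift_set_def S2_def)

lemma proj_image_lift_set: "proj ` lift_set U = U"
proof
  show "U \<subseteq> proj ` lift_set U"
  proof
    fix p assume "p \<in> U"
    obtain x where "x \<in> S2" "proj x = p" by (rule proj_surj)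
    with \<open>p \<in> U\<close> show "p \<in> proj ` lift_set U" by (auto simp: mem_lift_set)
  qed
qed (auto simp: mem_lift_set)

lemma inj_lift_set: "inj lift_set"
  by (metis injI proj_image_lift_set)

lemma lift_set_proj_image:
  assumes "X \<subseteq> S2"
  shows "lift_set (proj ` X) = X \<union> uminus ` X"
proof
  show "lift_set (proj ` X) \<subseteq> X \<union> uminus ` X"
  proof
    fix x assume "x \<in> lift_set (proj ` X)"
    then obtain y where y: "x \<in> S2" "y \<in> X" "proj y = proj x" by (auto simp: mem_lift_set)
    then have "x = y \<or> x = - y" using assms proj_eq_iff by blast
    with y(2) show "x \<in> X \<union> uminus ` X" by blast
  qed
  show "X \<union> uminus ` X \<subseteq> lift_set (proj ` X)"
  proof
    fix x assume "x \<in> X \<union> uminus ` X"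
    then obtain y where y: "y \<in> X" "x = y \<or> x = - y" by blast
    then have "y \<in> S2" using assms by blast
    with y show "x \<in> lift_set (proj ` X)" by (auto simp: mem_lift_set proj_uminus)
  qed
qed

lemma open_proj_plane_iff: "open U \<longleftrightarrow> openin (top_of_set S2) (lift_set U)"
  by (simp add: open_proj_plane_def S2_def)

lemma continuous_on_proj: "continuous_on S2 proj"
  unfolding continuous_openin_preimage_eq
proof (intro allI impI)
  fix T :: "proj_plane set" assume "open T"
  moreover have "S2 \<inter> proj -` T = lift_set T" by (auto simp: mem_lift_set)
  ultimately show "openin (top_of_set S2) (S2 \<inter> proj -` T)" by (simp add: open_proj_plane_iff)
qed

lemma openin_S2_uminus:
  assumes "openin (top_of_set S2) X"
  shows "openin (top_of_set S2) (uminus ` X)"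
proof -
  obtain T where T: "open T" "X = S2 \<inter> T" using assms by (auto simp: openin_open)
  have "x \<in> uminus ` X \<longleftrightarrow> x \<in> S2 \<inter> uminus ` T" for x
  proof -
    have m: "x \<in> uminus ` Z \<longleftrightarrow> - x \<in> Z" for Z by (metis image_iff minus_minus)
    show ?thesis unfolding T(2) Int_iff m by simp
  qed
  then have "uminus ` X = S2 \<inter> uminus ` T" by (rule set_eqI)
  then show ?thesis by (simp add: openin_open_Int open_negations T(1))
qed

lemma open_proj_image:
  assumes "openin (top_of_set S2) X"
  shows "open (proj ` X)"
  unfolding open_proj_plane_iff lift_set_proj_image[OF openin_imp_subset[OF assms]]
  by (intro openin_Un openin_S2_uminus assms)

lemma closed_proj_image:
  assumes "closed K" "K \<subseteq> S2"
  shows "closed (proj ` K)"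
proof -
  have "lift_set (- proj ` K) = S2 - lift_set (proj ` K)" by (auto simp: mem_lift_set)
  also have "\<dots> = S2 \<inter> - (K \<union> uminus ` K)" unfolding lift_set_proj_image[OF assms(2)] by blast
  finally have eq: "lift_set (- proj ` K) = S2 \<inter> - (K \<union> uminus ` K)" .
  have "openin (top_of_set S2) (lift_set (- proj ` K))"
    unfolding eq by (intro openin_open_Int open_Compl closed_Un closed_negations assms(1))
  then show ?thesis unfolding closed_def open_proj_plane_iff .
qed

text \<open>The open hemisphere \<open>H\<close> around \<open>y\<close> contains no antipodal pair, so the covering map restricts to a
  homeomorphism of \<open>H\<close> onto its open image.\<close>

lemma local_section:
  assumes "y \<in> S2"
  obtains N \<sigma> where "proj y \<in> N" "open N" "continuous_on N \<sigma>" "\<sigma> ` N \<subseteq> S2" "\<And>q. q \<in> N \<Longrightarrow> proj (\<sigma> q) = q"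
proof -
  define H where "H = S2 \<inter> {z. y \<bullet> z > 0}"
  have oH: "openin (top_of_set S2) H"
    unfolding H_def by (intro openin_open_Int open_halfspace_gt)
  have yH: "y \<in> H" using assms by (auto simp: H_def mem_S2)
  have inj: "inj_on proj H"
  proof (rule inj_onI)
    fix u v assume uv: "u \<in> H" "v \<in> H" "proj u = proj v"
    then have "v = u \<or> v = - u" using proj_eq_iff by (auto simp: H_def)
    then show "u = v" using uv by (auto simp: H_def)
  qed
  have 1: "inv_into H proj q \<in> H" "proj (inv_into H proj q) = q" if "q \<in> proj ` H" for q
    using that by (auto simp: inv_into_into f_inv_into_f)
  show thesis
  proof (rule that[of "proj ` H" "inv_into H proj"])
    show "proj y \<in> proj ` H" using yH by blast
    show "open (proj ` H)" using open_proj_image[OF oH] .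
    show "inv_into H proj ` proj ` H \<subseteq> S2" using 1 by (auto simp: H_def)
    show "continuous_on (proj ` H) (inv_into H proj)"
      unfolding continuous_openin_preimage_eq
    proof (intro allI impI)
      fix T :: "(real^3) set" assume "open T"
      have "proj ` H \<inter> inv_into H proj -` T = proj ` (H \<inter> T)"
        using inj by (auto simp: inv_into_f_f)
      moreover have "open (proj ` (H \<inter> T))"
      proof (rule open_proj_image)
        have "H \<inter> T = S2 \<inter> ({z. y \<bullet> z > 0} \<inter> T)" by (auto simp: H_def)
        then show "openin (top_of_set S2) (H \<inter> T)"
          using \<open>open T\<close> by (simp add: openin_open_Int open_halfspace_gt open_Int)
      qed
      ultimately show "openin (top_of_set (proj ` H)) (proj ` H \<inter> inv_into H proj -` T)"
        by (metis inf_le1 open_subset)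
    qed
  qed (use 1 in auto)
qed

text \<open>Local sections lift short pieces of the path, and two lifts of adjacent pieces can be glued after
  replacing one of them by its antipode if necessary; Bolzano's bisection principle does the rest.\<close>

lemma path_lift:
  fixes g :: "real \<Rightarrow> proj_plane"
  assumes "path g"
  obtains h where "path h" "path_image h \<subseteq> S2" "\<forall>t\<in>{0..1}. proj (h t) = g t"
proof -
  define L where "L a b h \<longleftrightarrow> continuous_on {a..b} h \<and> h ` {a..b} \<subseteq> S2 \<and> (\<forall>t\<in>{a..b}. proj (h t) = g t)"
    for a b and h :: "real \<Rightarrow> real^3"
  have "0 \<le> (0::real) \<and> (1::real) \<le> 1 \<longrightarrow> (\<exists>h. L 0 1 h)"
  proof (rule Bolzano[where P = "\<lambda>a b. 0 \<le> a \<and> b \<le> 1 \<longrightarrow> (\<exists>h. L a b h)"])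
    show "0 \<le> (1::real)" by simp
  next
    fix a b c :: real
    assume ab: "0 \<le> a \<and> b \<le> 1 \<longrightarrow> (\<exists>h. L a b h)" and bc: "0 \<le> b \<and> c \<le> 1 \<longrightarrow> (\<exists>h. L b c h)"
      and le: "a \<le> b" "b \<le> c"
    show "0 \<le> a \<and> c \<le> 1 \<longrightarrow> (\<exists>h. L a c h)"
    proof
      assume ac: "0 \<le> a \<and> c \<le> 1"
      then obtain h k where h: "L a b h" and k: "L b c k" using ab bc le by force
      have "proj (h b) = proj (k b)" "h b \<in> S2" "k b \<in> S2" using h k le by (auto simp: L_def)
      then have "k b = h b \<or> k b = - h b" using proj_eq_iff by blast
      moreover have "L b c (\<lambda>t. - k t)"
        using k proj_uminus unfolding L_def by (auto intro!: continuous_intros)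
      ultimately obtain k' where k': "L b c k'" "k' b = h b"
        using k by (metis minus_minus)
      have "L a c (\<lambda>t. if t \<le> b then h t else k' t)"
        unfolding L_def
      proof (intro conjI)
        have "continuous_on ({a..b} \<union> {b..c}) (\<lambda>t. if t \<le> b then h t else k' t)"
          by (rule continuous_on_cases) (use h k' in \<open>auto simp: L_def\<close>)
        then show "continuous_on {a..c} (\<lambda>t. if t \<le> b then h t else k' t)"
          using le by (simp add: ivl_disj_un_two_touch)
        show "(\<lambda>t. if t \<le> b then h t else k' t) ` {a..c} \<subseteq> S2"
          using h k' by (auto simp: L_def image_subset_iff)
        show "\<forall>t\<in>{a..c}. proj (if t \<le> b then h t else k' t) = g t"
          using h k' by (auto simp: L_def)
      qed
      then show "\<exists>h. L a c h" by (rule exI[of "L a c"])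
    qed
  next
    fix x :: real assume x: "0 \<le> x" "x \<le> 1"
    obtain y where y: "y \<in> S2" "proj y = g x" by (rule proj_surj)
    obtain N \<sigma> where N: "g x \<in> N" "open N" "continuous_on N \<sigma>" "\<sigma> ` N \<subseteq> S2"
      "\<And>q. q \<in> N \<Longrightarrow> proj (\<sigma> q) = q"
      using local_section[OF y(1)] y(2) by metis
    have gc: "continuous_on {0..1} g" using assms by (simp add: path_def)
    then have "openin (top_of_set {0..1}) ({0..1} \<inter> g -` N)"
      using N(2) by (simp add: continuous_openin_preimage_eq)
    then obtain d where d: "d > 0" "\<And>t. t \<in> {0..1} \<Longrightarrow> dist t x < d \<Longrightarrow> g t \<in> N"
      using x N(1) unfolding openin_euclidean_subtopology_iff by force
    show "\<exists>d>0. \<forall>a b. a \<le> x \<and> x \<le> b \<and> b - a < d \<longrightarrow> 0 \<le> a \<and> b \<le> 1 \<longrightarrow> (\<exists>h. L a b h)"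
    proof (intro exI[of _ d] conjI allI impI d(1))
      fix a b assume ab: "a \<le> x \<and> x \<le> b \<and> b - a < d" "0 \<le> a \<and> b \<le> 1"
      have gN: "g t \<in> N" if "t \<in> {a..b}" for t
        using ab that by (intro d(2)) (auto simp: dist_real_def)
      have "continuous_on {a..b} (\<sigma> \<circ> g)"
        by (intro continuous_on_compose continuous_on_subset[OF gc] continuous_on_subset[OF N(3)])
           (use ab gN in auto)
      then have "L a b (\<sigma> \<circ> g)" using gN N(4,5) by (auto simp: L_def)
      then show "\<exists>h. L a b h" by (rule exI[of "L a b"])
    qed
  qed
  then obtain h where "L 0 1 h" by auto
  then show thesis
    using that[of h] by (simp add: L_def path_def path_image_def)
qed

text \<open>The lifted path ends at the antipode of its starting point, because otherwise it would be
  a contractible loop, and so would be its projection.\<close>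

lemma pseudoline_lift:
  assumes "pseudoline P"
  shows "antipodal_curve (lift_set P)"
proof -
  obtain g where g: "simple_path g" "pathfinish g = pathstart g" "path_image g = P"
    and ess: "\<nexists>a. homotopic_loops UNIV g (\<lambda>t. a)"
    using assms unfolding pseudoline_def by blast
  have gp: "path g" using g(1) simple_path_imp_path by blast
  have g01: "g 0 = g 1" using g(2) by (simp add: pathstart_def pathfinish_def)
  obtain h where h: "path h" "path_image h \<subseteq> S2" "\<forall>t\<in>{0..1}. proj (h t) = g t"
    by (rule path_lift[OF gp])
  have hS: "h t \<in> S2" if "t \<in> {0..1}" for t using h(2) that by (auto simp: path_image_def)
  have eq: "s = t \<or> s = 0 \<and> t = 1 \<or> s = 1 \<and> t = 0"
    if "h s = h t \<or> h s = - h t" "s \<in> {0..1}" "t \<in> {0..1}" for s t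
  proof -
    have "proj (h s) = proj (h t)" using that hS proj_uminus by metis
    then have "g s = g t" using h(3) that by simp
    then show ?thesis using g(1) that unfolding simple_path_def loop_free_def by blast
  qed
  have "proj (h 0) = proj (h 1)" using h(3) g01 by simp
  then have "h 1 = h 0 \<or> h 1 = - h 0" using proj_eq_iff hS by simp
  moreover have "h 1 \<noteq> h 0"
  proof
    assume h01: "h 1 = h 0"
    have "simply_connected S2" unfolding S2_def by (rule simply_connected_sphere) simp
    then have "homotopic_loops S2 h (linepath (h 0) (h 0))"
      using h(1,2) hS[of 0] h01 unfolding simply_connected_eq_contractible_loop_any
      by (auto simp: pathstart_def pathfinish_def)
    then have "homotopic_loops UNIV (proj \<circ> h) (proj \<circ> linepath (h 0) (h 0))"
      by (rule homotopic_loops_continuous_image[OF _ continuous_on_proj]) simp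
    moreover have "homotopic_loops UNIV g (proj \<circ> h)"
      by (rule homotopic_loops_eq) (use gp g(2) h(3) in auto)
    moreover have "proj \<circ> linepath (h 0) (h 0) = (\<lambda>t. proj (h 0))" by (auto simp: linepath_refl)
    ultimately show False using ess homotopic_loops_trans by metis
  qed
  ultimately have h1: "h 1 = - h 0" by blast
  have hneq: "h t \<noteq> - h t" if "t \<in> {0..1}" for t using S2_neq_uminus[OF hS[OF that]] by metis
  show ?thesis
    unfolding antipodal_curve_def
  proof (intro exI[of _ h] conjI)
    show "arc h"
      unfolding arc_def
    proof (intro conjI h(1) inj_onI)
      fix s t :: real assume st: "s \<in> {0..1}" "t \<in> {0..1}" "h s = h t"
      then consider "s = t" | "s = 0 \<and> t = 1" | "s = 1 \<and> t = 0" using eq by blast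
      then show "s = t"
        by cases (use st h1 hneq[of 0] in auto)
    qed
    show "pathfinish h = - pathstart h" using h1 by (simp add: pathstart_def pathfinish_def)
    show "path_image h \<subseteq> S2" by (rule h(2))
    show "path_image h \<inter> uminus ` path_image h = {pathstart h, pathfinish h}"
    proof
      show "path_image h \<inter> uminus ` path_image h \<subseteq> {pathstart h, pathfinish h}"
      proof
        fix x assume "x \<in> path_image h \<inter> uminus ` path_image h"
        then obtain s t where st: "s \<in> {0..1}" "t \<in> {0..1}" "x = h s" "x = - h t"
          unfolding path_image_def by blast
        then have "s = t \<or> s = 0 \<or> s = 1" using eq[of s t] by auto
        then show "x \<in> {pathstart h, pathfinish h}"
          using st hneq[of s] by (auto simp: pathstart_def pathfinish_def)
      qed
      have "h 0 = - h 1" using h1 by simp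
      moreover have "h 0 \<in> path_image h" "h 1 \<in> path_image h" by (simp_all add: path_image_def)
      ultimately show "{pathstart h, pathfinish h} \<subseteq> path_image h \<inter> uminus ` path_image h"
        using h1 unfolding pathstart_def pathfinish_def by blast
    qed
    have "P = proj ` path_image h"
      unfolding g(3)[symmetric] path_image_def image_image using h(3) by simp
    then show "lift_set P = path_image h \<union> uminus ` path_image h"
      using lift_set_proj_image[OF h(2)] by simp
  qed
qed

lemma antipodal_arrangement_lift:
  assumes "pseudoline_arrangement A"
  shows "antipodal_arrangement (lift_arrangement A)"
proof
  show "finite (lift_arrangement A)"
    using assms by (simp add: pseudoline_arrangement_def lift_arrangement_def)
  show "antipodal_curve C" if "C \<in> lift_arrangement A" for C
    using that assms pseudoline_lift by (auto simp: pseudoline_arrangement_def lift_arrangement_def)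
  fix C D assume CD: "C \<in> lift_arrangement A" "D \<in> lift_arrangement A" "C \<noteq> D"
  then obtain P Q where PQ: "P \<in> A" "Q \<in> A" "C = lift_set P" "D = lift_set Q" "P \<noteq> Q"
    unfolding lift_arrangement_def by blast
  then obtain p where p: "P \<inter> Q = {p}" using assms unfolding pseudoline_arrangement_def by blast
  obtain x where x: "x \<in> S2" "proj x = p" by (rule proj_surj)
  have "C \<inter> D = lift_set (proj ` {x})" unfolding PQ(3,4) using p x by (auto simp: mem_lift_set)
  also have "\<dots> = {x, - x}" using lift_set_proj_image[of "{x}"] x by auto
  finally show "\<exists>x. C \<inter> D = {x, - x}" ..
qed

section \<open>Cells of the projective arrangement\<close>

locale lifted_arrangement =
  fixes A :: "proj_plane set set"
  assumes arr: "pseudoline_arrangement A"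
begin

sublocale antipodal_arrangement "lift_arrangement A"
  by (rule antipodal_arrangement_lift[OF arr])

abbreviation "cell a \<equiv> region (lift_arrangement A) a"

lemma mem_generic_iff: "x \<in> generic \<longleftrightarrow> x \<in> S2 \<and> proj x \<notin> \<Union>A"
  unfolding generic_def by (auto simp: lift_arrangement_def mem_lift_set)

lemma mem_vertices_iff: "x \<in> S2 \<Longrightarrow> x \<in> vertices \<longleftrightarrow> proj x \<in> arr_vertices A"
  unfolding arr_vertices_def lift_arrangement_def
  using inj_lift_set by (auto simp: mem_lift_set inj_eq)

lemma cell_subset: "cell a \<subseteq> S2" "closure (cell a) \<subseteq> S2"
proof -
  show 1: "cell a \<subseteq> S2" by (auto simp: region_def)
  show "closure (cell a) \<subseteq> S2" by (rule closure_minimal[OF 1 closed_S2])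
qed

lemma closure_proj_cell: "closure (proj ` cell a) = proj ` closure (cell a)"
proof
  show "closure (proj ` cell a) \<subseteq> proj ` closure (cell a)"
    by (intro closure_minimal image_mono closure_subset closed_proj_image closed_closure cell_subset)
  show "proj ` closure (cell a) \<subseteq> closure (proj ` cell a)"
    by (rule image_closure_subset[OF continuous_on_subset[OF continuous_on_proj cell_subset(2)]])
       (simp_all add: closure_subset)
qed

text \<open>The image of a cell of the lift is open, and it is relatively closed in the complement of the
  pseudolines; being connected, it is a component.\<close>

lemma proj_cell:
  assumes a: "a \<in> generic"
  shows "proj ` cell a \<in> cells UNIV A"
proof -
  define Y where "Y = connected_component_set (UNIV - \<Union>A) (proj a)"
  have aS: "a \<in> S2" "proj a \<notin> \<Union>A" using a mem_generic_iff by auto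
  have ac: "a \<in> cell a" using region_refl[of "lift_arrangement A" a] genericD[OF a] by blast
  have cg: "cell a \<subseteq> generic"
    using side_subset unfolding region_def generic_def by blast
  have con: "connected (cell a)" using connected_region[of "lift_arrangement A" a] genericD[OF a] by blast
  have "proj ` cell a \<subseteq> Y"
    unfolding Y_def
  proof (rule connected_component_maximal)
    show "proj a \<in> proj ` cell a" using ac by blast
    show "connected (proj ` cell a)"
      by (rule connected_continuous_image[OF continuous_on_subset[OF continuous_on_proj cell_subset(1)] con])
    show "proj ` cell a \<subseteq> UNIV - \<Union>A" using cg mem_generic_iff by blast
  qed
  moreover have "Y \<inter> proj ` closure (cell a) \<subseteq> proj ` cell a"
  proof
    fix y assume y: "y \<in> Y \<inter> proj ` closure (cell a)"
    then obtain x where x: "x \<in> closure (cell a)" "y = proj x" by blast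
    have "y \<notin> \<Union>A" using y connected_component_subset unfolding Y_def by blast
    then have "x \<in> generic" using x cell_subset(2) mem_generic_iff by blast
    then show "y \<in> proj ` cell a" using closure_region_generic x by blast
  qed
  ultimately have eq: "proj ` cell a = Y \<inter> proj ` closure (cell a)"
    using closure_subset[of "cell a"] by blast
  have "closedin (top_of_set Y) (proj ` cell a)"
    by (subst eq) (intro closedin_closed_Int closed_proj_image closed_closure cell_subset)
  moreover have "openin (top_of_set Y) (proj ` cell a)"
    by (intro open_subset \<open>proj ` cell a \<subseteq> Y\<close> open_proj_image openin_region) simp
  moreover have "connected Y" by (simp add: Y_def)
  ultimately have "proj ` cell a = {} \<or> proj ` cell a = Y"
    unfolding connected_clopen by blast
  then have "proj ` cell a = Y" using ac by blast
  then show ?thesis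
    unfolding cells_def using aS by (auto simp: Y_def intro: componentsI)
qed

text \<open>An edge \<open>e\<close> of the projective arrangement through a limit point of the cell consists of such limit
  points: \<open>e\<close> is connected, and its points in the closure of the projected cell form a closed
  subset, which is also open because it is \<open>e \<inter> proj ` N\<close>, where \<open>N\<close> is the open region of the curves other than the one
  above \<open>P\<close>.\<close>

lemma bordering_lift_iff:
  assumes a: "a \<in> generic" and P: "P \<in> A"
  shows "lift_set P \<in> bordering a \<longleftrightarrow> (\<exists>e \<in> sides A (proj ` cell a). e \<subseteq> P)"
proof -
  have CL: "lift_set P \<in> lift_arrangement A" using P by (simp add: lift_arrangement_def)
  show ?thesis
  proof
    assume "\<exists>e \<in> sides A (proj ` cell a). e \<subseteq> P"
    then obtain e Q where e: "e \<subseteq> P" "e \<in> components (Q - arr_vertices A)" "e \<subseteq> proj ` closure (cell a)"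
      unfolding sides_def arr_edges_def closure_proj_cell by blast
    obtain z where z: "z \<in> e" using in_components_nonempty[OF e(2)] by blast
    then obtain x where x: "x \<in> closure (cell a)" "z = proj x" using e(3) by blast
    have "z \<notin> arr_vertices A" using z in_components_subset[OF e(2)] by blast
    then have "x \<in> lift_set P - vertices"
      using x z e(1) cell_subset(2) mem_vertices_iff by (auto simp: mem_lift_set)
    then show "lift_set P \<in> bordering a" using x(1) CL by (auto simp: bordering_def)
  next
    assume "lift_set P \<in> bordering a"
    then obtain x where x: "x \<in> lift_set P - vertices" "x \<in> closure (cell a)"
      unfolding bordering_def by blast
    define e where "e = connected_component_set (P - arr_vertices A) (proj x)"
    define N where "N = region (lift_arrangement A - {lift_set P}) a"
    have px: "proj x \<in> P - arr_vertices A" using x(1) mem_vertices_iff by (auto simp: mem_lift_set)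
    have e: "e \<in> components (P - arr_vertices A)" "proj x \<in> e" "connected e"
      unfolding e_def using px by (auto simp: componentsI)
    have key: "y \<in> closure (cell a) \<longleftrightarrow> y \<in> N" if y: "y \<in> S2" "proj y \<in> e" for y
    proof -
      have "proj y \<in> P - arr_vertices A" using y in_components_subset[OF e(1)] by blast
      then have "y \<in> lift_set P - vertices" using y mem_vertices_iff by (auto simp: mem_lift_set)
      then show ?thesis using closure_region_iff[OF a CL] y(1) unfolding N_def region_def by blast
    qed
    have NS: "N \<subseteq> S2" by (auto simp: N_def region_def)
    have eq: "e \<inter> proj ` closure (cell a) = e \<inter> proj ` N"
      using key cell_subset(2) NS by blast
    have "openin (top_of_set e) (e \<inter> proj ` closure (cell a))"
      unfolding eq N_def by (intro openin_open_Int open_proj_image openin_region) auto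
    moreover have "closedin (top_of_set e) (e \<inter> proj ` closure (cell a))"
      by (intro closedin_closed_Int closed_proj_image closed_closure cell_subset)
    ultimately have "e \<inter> proj ` closure (cell a) = {} \<or> e \<inter> proj ` closure (cell a) = e"
      using e(3) unfolding connected_clopen by blast
    then have "e \<subseteq> proj ` closure (cell a)" using e(2) x(2) by blast
    then have "e \<in> sides A (proj ` cell a)"
      unfolding sides_def arr_edges_def closure_proj_cell using e(1) P by blast
    moreover have "e \<subseteq> P" using in_components_subset[OF e(1)] by blast
    ultimately show "\<exists>e \<in> sides A (proj ` cell a). e \<subseteq> P" by blast
  qed
qed

text \<open>A side of a cell lies on one pseudoline only, so the three sides of a triangle determine exactly
  three bordering pseudolines.\<close>

lemma card_bordering_triangle:
  assumes a: "a \<in> generic" and tri: "triangle A (proj ` cell a)"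
  shows "card (bordering a) = 3"
proof -
  obtain P Q R e f g where PQR: "P \<in> A" "Q \<in> A" "R \<in> A" "P \<noteq> Q" "Q \<noteq> R" "P \<noteq> R"
    and efg: "e \<subseteq> P" "f \<subseteq> Q" "g \<subseteq> R" "sides A (proj ` cell a) = {e, f, g}"
    using tri unfolding triangle_def by - (elim bexE exE conjE, rule that; assumption)
  have one: "X = Y" if ks: "k \<in> sides A (proj ` cell a)" and "k \<subseteq> X" "k \<subseteq> Y" "X \<in> A" "Y \<in> A" for k X Y
  proof -
    obtain Z where k: "k \<in> components (Z - arr_vertices A)"
      using ks unfolding sides_def arr_edges_def by blast
    obtain z where "z \<in> k" using in_components_nonempty[OF k] by blast
    moreover from this have "z \<notin> arr_vertices A" using in_components_subset[OF k] by blast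
    ultimately show ?thesis using that unfolding arr_vertices_def by blast
  qed
  have "bordering a \<subseteq> lift_set ` A"
    unfolding bordering_def lift_arrangement_def[symmetric] by (rule Collect_restrict)
  then have "bordering a = lift_set ` {X \<in> A. lift_set X \<in> bordering a}"
    by blast
  also have "{X \<in> A. lift_set X \<in> bordering a} = {P, Q, R}"
  proof
    show "{X \<in> A. lift_set X \<in> bordering a} \<subseteq> {P, Q, R}"
    proof
      fix X assume X: "X \<in> {X \<in> A. lift_set X \<in> bordering a}"
      then obtain k where k: "k \<in> sides A (proj ` cell a)" "k \<subseteq> X" using bordering_lift_iff[OF a] by blast
      then consider "k = e" | "k = f" | "k = g" unfolding efg(4) by blast
      then show "X \<in> {P, Q, R}"
        by cases (use one[OF k] X PQR efg in blast)+
    qed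
    show "{P, Q, R} \<subseteq> {X \<in> A. lift_set X \<in> bordering a}"
      using bordering_lift_iff[OF a] PQR efg by blast
  qed
  finally have "card (bordering a) = card {P, Q, R}"
    using card_image[OF inj_on_subset[OF inj_lift_set], of "{P, Q, R}"] by simp
  then show ?thesis using PQR by simp
qed

lemma arrangement_graph_eq: "arrangement_graph A = graph"
  by (simp add: arrangement_graph_def S2_def)

lemma cubic_arrangement_graph:
  assumes "simplicial A"
  shows "cubic (arrangement_graph A)"
  unfolding cubic_def arrangement_graph_eq
proof
  fix v assume "v \<in> fst graph"
  then obtain a where a: "a \<in> generic" "v = cell a"
    unfolding dual_graph_def cells_eq by auto
  have "triangle A (proj ` cell a)"
    using assms proj_cell[OF a(1)] unfolding simplicial_def by blast
  then show "card {e \<in> snd graph. v \<in> e} = 3"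
    using card_incident_edges[OF a(1)] card_bordering_triangle[OF a(1)] a(2) by simp
qed

end

theorem theorem4:
  fixes A :: "proj_plane set set"
  assumes "pseudoline_arrangement A"
  shows "partial_cube (arrangement_graph A) \<and>
         (simplicial A \<longrightarrow> cubic (arrangement_graph A))"
proof -
  interpret lifted_arrangement A
    by unfold_locales (rule assms)
  show ?thesis
    using partial_cube_graph cubic_arrangement_graph by (simp add: arrangement_graph_eq)
qed

end
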